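(* There exists $p_0$ such that for every prime $p\ge p_0$ the following holds. If $p=\frac{k(k+1)}{2} -2$ or $p=\frac{k(k+1)}{2} -4$ for some positive integer $k$, then $\mathsf{SD}(C_p)=\mathsf{O}(C_p)$. Otherwise, $\mathsf{SD}(C_p)= \mathsf{O}(C_p)-1$.
   Context: $C_p$ denotes a cyclic group of order $p$; groups are written additively. For a finite abelian group $G$, the Olson constant $\mathsf{O}(G)$ is the smallest integer $\ell$ such that every subset $S\subset G$ with $|S|\ge \ell$ has a non-empty subset whose elements sum to $0$. The Strong Davenport constant $\mathsf{SD}(G)$ is the maximal cardinality of a minimal zero-sum set in $G$, i.e., of a non-empty subset of $G$ whose elements sum to $0$ and none of whose proper non-empty subsets has sum $0$. *)

theory Defs
  imports Complex_Main "HOL-Algebra.FiniteProduct" "HOL-Algebra.Elementary_Groups" "HOL-Computational_Algebra.Primes"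
begin

text \<open>
  The group operation of \<open>G :: 'a monoid\<close> is written multiplicatively in HOL-Algebra; the sum
  of the elements of a finite set \<open>S \<subseteq> carrier G\<close> in an additively written group is therefore
  \<open>finprod G (\<lambda>x. x) S\<close>, and \<open>0\<close> is \<open>\<one>\<^bsub>G\<^esub>\<close>.  The definitions are intended for finite abelian
  groups.
\<close>

definition zero_sum_set :: "('a, 'b) monoid_scheme \<Rightarrow> 'a set \<Rightarrow> bool" where
  "zero_sum_set G S \<longleftrightarrow>
     S \<noteq> {} \<and> S \<subseteq> carrier G \<and> finprod G (\<lambda>x. x) S = \<one>\<^bsub>G\<^esub>"

definition minimal_zero_sum_set :: "('a, 'b) monoid_scheme \<Rightarrow> 'a set \<Rightarrow> bool" where
  "minimal_zero_sum_set G S \<longleftrightarrow>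
     zero_sum_set G S \<and> (\<forall>T. T \<subset> S \<longrightarrow> \<not> zero_sum_set G T)"

text \<open>
  For finite \<open>G\<close> the \<open>LEAST\<close> exists, since \<open>l = order G + 1\<close> qualifies vacuously.
\<close>

definition olson_constant :: "('a, 'b) monoid_scheme \<Rightarrow> nat" where
  "olson_constant G =
     (LEAST l. \<forall>S. S \<subseteq> carrier G \<and> card S \<ge> l \<longrightarrow> (\<exists>T. T \<subseteq> S \<and> zero_sum_set G T))"

text \<open>
  For a finite abelian group \<open>G\<close> the maximum is over a finite set, nonempty because \<open>{\<one>\<^bsub>G\<^esub>}\<close> is
  a minimal zero-sum set.
\<close>

definition strong_davenport_constant :: "('a, 'b) monoid_scheme \<Rightarrow> nat" where
  "strong_davenport_constant G = Max {card S | S. minimal_zero_sum_set G S}"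

end

theory Submission
  imports Defs "Jordan_Normal_Form.Determinant" "HOL-Number_Theory.Residues"
begin

text \<open>
  Let \<open>K\<close> be least with \<open>K * (K + 1) / 2 \<ge> p\<close>. The set \<open>{1..K - 1}\<close> is zero-sum free in \<open>C_p\<close>, and
  \<open>zero_sum_free_bound\<close> shows that no zero-sum free set is larger; so the Olson constant is \<open>K\<close>. A
  minimal zero-sum set becomes zero-sum free when an element is removed, so its size is at most
  \<open>K\<close>, and size \<open>K - 1\<close> occurs. Everything thus depends on whether a minimal zero-sum set
  with \<open>K\<close> elements exists. Writing \<open>K * (K + 1) / 2 = p + \<delta>\<close>, the sets \<open>{- 1, 2, 3, \<dots>, K}\<close> and
  \<open>{- 2, 1, 3, 4, \<dots>, K}\<close> settle \<open>\<delta> = 2\<close> and \<open>\<delta> = 4\<close>, and \<open>minimal_zero_sum_excess\<close> excludes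
  all other values.
  
  Both impossibility results come from a polynomial method. For integers \<open>a_1, \<dots>, a_n\<close>
  representing the set, take an alternating polynomial \<open>D\<close>, a determinant of powers, and consider
  
    \<open>\<Sum>\<epsilon>. (\<Prod>i. \<epsilon>_i) * (\<Sum>i. \<epsilon>_i * a_i) ^ M * D(\<epsilon>_1 * a_1, \<dots>, \<epsilon>_n * a_n)\<close>
  
  over all signs \<open>\<epsilon>_i\<close>. The sum over signs keeps only monomials with odd exponents, and
  antisymmetry only those with distinct exponents, so the expression vanishes when its degree is
  less than \<open>1 + 3 + \<dots> + (2 * n - 1) = n ^ 2\<close> (\<open>signed_moment_eq_0\<close>). In degree exactly \<open>n ^ 2\<close> it is
  \<open>\<Prod>i. a_i\<close> times the Vandermonde determinant of the squares times a coefficient that depends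
  only on \<open>D\<close> (\<open>signed_moment_top\<close>). On the other hand, for \<open>M = p - 1\<close> Fermat's theorem makes
  the power equal to \<open>1\<close> modulo \<open>p\<close> except where a signed sum, that is, essentially a subset sum,
  is zero. For a zero-sum free set (after a shift by the total) there is one exception, for a minimal
  zero-sum set there are two, namely all signs equal, and what remains of the expression is a
  multiple of \<open>D(a)\<close>.
  
  Choosing \<open>D\<close> as the Vandermonde determinant gives the bound for zero-sum free sets. For a minimal
  zero-sum set of size \<open>K\<close> and excess \<open>\<delta>\<close>, the choices of degree below \<open>n ^ 2\<close> force \<open>\<delta>\<close> to be even and
  the complete symmetric polynomials of odd degree less than \<open>\<delta>\<close> to vanish at \<open>a\<close>. If \<open>\<delta> \<ge> 6\<close>, this
  annihilates the Schur polynomial of the partition \<open>(\<delta> - 2, 3)\<close>, while its universal coefficient in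
  degree \<open>n ^ 2\<close> turns out to be invertible modulo \<open>p\<close> (\<open>falling_minor\<close>): a contradiction.
\<close>

section \<open>Generalised alternants\<close>

text \<open>
  For \<open>z = 0\<close> the entries are the powers \<open>y i ^ r j\<close>, for \<open>z = int\<close> they are the falling
  factorials of the \<open>y i\<close>. Both cases are needed: the first is where the set under
  investigation lives, the second appears as a universal coefficient. A common
  definition makes one recursion and one Newton expansion serve for both.
\<close>

definition alternant :: "nat \<Rightarrow> (nat \<Rightarrow> int) \<Rightarrow> (nat \<Rightarrow> int) \<Rightarrow> (nat \<Rightarrow> nat) \<Rightarrow> int" where
  "alternant n z y r = det (mat n n (\<lambda>(i, j). \<Prod>s<r j. y i - z s))"

lemma alternant_altdef:
  "alternant n z y r =
     (\<Sum>\<sigma> | \<sigma> permutes {..<n}. signof \<sigma> * (\<Prod>i<n. \<Prod>s<r (\<sigma> i). y i - z s))"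
proof -
  have "alternant n z y r = (\<Sum>\<sigma> | \<sigma> permutes {0..<n}. signof \<sigma> *
          (\<Prod>i = 0..<n. mat n n (\<lambda>(i, j). \<Prod>s<r j. y i - z s) $$ (i, \<sigma> i)))"
    unfolding alternant_def by (subst det_def'[of _ n]) auto
  also have "\<dots> = (\<Sum>\<sigma> | \<sigma> permutes {0..<n}. signof \<sigma> * (\<Prod>i = 0..<n. \<Prod>s<r (\<sigma> i). y i - z s))"
  proof (intro sum.cong refl arg_cong2[where f = "(*)"] prod.cong)
    fix \<sigma> i assume "\<sigma> \<in> {\<sigma>. \<sigma> permutes {0..<n}}" "i \<in> {0..<n}"
    then have "\<sigma> i < n" "i < n" by (auto dest: permutes_in_image[of \<sigma> "{0..<n}" i])
    then show "mat n n (\<lambda>(i, j). \<Prod>s<r j. y i - z s) $$ (i, \<sigma> i) = (\<Prod>s<r (\<sigma> i). y i - z s)"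
      by simp
  qed
  finally show ?thesis by (simp add: atLeast0LessThan)
qed

lemma alternant_cong:
  assumes "\<And>i. i < n \<Longrightarrow> y i = y' i" "\<And>j. j < n \<Longrightarrow> r j = r' j"
  shows "alternant n z y r = alternant n z y' r'"
  unfolding alternant_def using assms by (intro arg_cong[where f = det] eq_matI) auto

lemma alternant_eq_0:
  assumes "i < n" "j < n" "i \<noteq> j" "r i = r j"
  shows "alternant n z y r = 0"
  unfolding alternant_def
  by (rule det_identical_columns[of _ n i j]) (use assms in \<open>auto intro!: eq_vecI\<close>)

lemma alternant_permute:
  assumes "\<pi> permutes {..<n}"
  shows "alternant n z y (r \<circ> \<pi>) = signof \<pi> * alternant n z y r"
proof -
  let ?A = "mat n n (\<lambda>(j, i). \<Prod>s<r j. y i - z s)"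
  have lt: "\<pi> j < n" if "j < n" for j
    using permutes_in_image[OF assms, of j] that by simp
  have tr: "alternant n z y q = det (mat n n (\<lambda>(j, i). \<Prod>s<q j. y i - z s))" for q
    unfolding alternant_def
    by (subst det_transpose[symmetric, of _ n]) (auto intro!: arg_cong[where f = det] eq_matI)
  have "alternant n z y (r \<circ> \<pi>) = det (mat n n (\<lambda>(j, i). ?A $$ (\<pi> j, i)))"
    unfolding tr by (intro arg_cong[where f = det] eq_matI) (auto simp: lt)
  also have "\<dots> = signof \<pi> * alternant n z y r"
    unfolding tr using assms by (intro det_permute_rows) (auto simp: atLeast0LessThan)
  finally show ?thesis .
qed

text \<open>
  Raising an exponent \<open>r j\<close> by one multiplies the entries of column \<open>j\<close> by \<open>y i - z (r j)\<close>. In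
  each term of the Leibniz expansion every row is hit exactly once, so these factors add up
  to the total of the \<open>y i\<close> minus the total of the \<open>z (r j)\<close>. For powers this is the rule for
  multiplying an alternant by the first power sum; for falling factorials the left-hand factor
  is the number of steps that remain up to the top degree.
\<close>

lemma alternant_step:
  "((\<Sum>i<n. y i) - (\<Sum>j<n. z (r j))) * alternant n z y r =
     (\<Sum>j<n. alternant n z y (r(j := Suc (r j))))"
proof -
  define P where "P \<sigma> = signof \<sigma> * (\<Prod>i<n. \<Prod>s<r (\<sigma> i). y i - z s)" for \<sigma>
  have summand: "(\<Sum>j<n. signof \<sigma> * (\<Prod>i<n. \<Prod>s<(r(j := Suc (r j))) (\<sigma> i). y i - z s))
      = ((\<Sum>i<n. y i) - (\<Sum>j<n. z (r j))) * P \<sigma>" if \<sigma>: "\<sigma> permutes {..<n}" for \<sigma>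
  proof -
    have one: "signof \<sigma> * (\<Prod>i<n. \<Prod>s<(r(\<sigma> k := Suc (r (\<sigma> k)))) (\<sigma> i). y i - z s)
        = (y k - z (r (\<sigma> k))) * P \<sigma>" if k: "k < n" for k
    proof -
      have "(\<Prod>i<n. \<Prod>s<(r(\<sigma> k := Suc (r (\<sigma> k)))) (\<sigma> i). y i - z s)
          = (\<Prod>i<n. (if i = k then y k - z (r (\<sigma> k)) else 1) * (\<Prod>s<r (\<sigma> i). y i - z s))"
        using permutes_inj[OF \<sigma>] by (intro prod.cong) (auto simp: inj_eq)
      also have "\<dots> = (y k - z (r (\<sigma> k))) * (\<Prod>i<n. \<Prod>s<r (\<sigma> i). y i - z s)"
        using k by (simp add: prod.distrib)
      finally show ?thesis by (simp add: P_def)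
    qed
    have "(\<Sum>j<n. signof \<sigma> * (\<Prod>i<n. \<Prod>s<(r(j := Suc (r j))) (\<sigma> i). y i - z s))
        = (\<Sum>k<n. signof \<sigma> * (\<Prod>i<n. \<Prod>s<(r(\<sigma> k := Suc (r (\<sigma> k)))) (\<sigma> i). y i - z s))"
      by (subst sum.permute[OF \<sigma>]) (simp add: o_def)
    also have "\<dots> = (\<Sum>k<n. (y k - z (r (\<sigma> k))) * P \<sigma>)"
      by (intro sum.cong refl one) simp
    also have "\<dots> = ((\<Sum>k<n. y k) - (\<Sum>k<n. z (r (\<sigma> k)))) * P \<sigma>"
      by (simp add: sum_distrib_right[symmetric] sum_subtractf)
    also have "(\<Sum>k<n. z (r (\<sigma> k))) = (\<Sum>j<n. z (r j))"
      by (subst (2) sum.permute[OF \<sigma>]) (simp add: o_def)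
    finally show ?thesis .
  qed
  have "(\<Sum>j<n. alternant n z y (r(j := Suc (r j))))
      = (\<Sum>\<sigma> | \<sigma> permutes {..<n}. \<Sum>j<n.
           signof \<sigma> * (\<Prod>i<n. \<Prod>s<(r(j := Suc (r j))) (\<sigma> i). y i - z s))"
    unfolding alternant_altdef by (rule sum.swap)
  also have "\<dots> = (\<Sum>\<sigma> | \<sigma> permutes {..<n}. ((\<Sum>i<n. y i) - (\<Sum>j<n. z (r j))) * P \<sigma>)"
    by (intro sum.cong refl summand) auto
  also have "\<dots> = ((\<Sum>i<n. y i) - (\<Sum>j<n. z (r j))) * alternant n z y r"
    unfolding alternant_altdef P_def by (simp add: sum_distrib_left)
  finally show ?thesis by simp
qed

section \<open>Newton interpolation of alternants\<close>

text \<open>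
  The coefficient of \<open>\<Prod>t<j. x - y t\<close> in the expansion of \<open>\<Prod>s<k. x - z s\<close>. For \<open>z = 0\<close>
  it is the complete homogeneous symmetric polynomial of degree \<open>k - j\<close> in \<open>y 0, \<dots>, y j\<close>.
\<close>

fun newton_coeff :: "(nat \<Rightarrow> int) \<Rightarrow> (nat \<Rightarrow> int) \<Rightarrow> nat \<Rightarrow> nat \<Rightarrow> int" where
  "newton_coeff z y 0 j = (if j = 0 then 1 else 0)"
| "newton_coeff z y (Suc k) j =
     (if j = 0 then 0 else newton_coeff z y k (j - 1)) + (y j - z k) * newton_coeff z y k j"

lemma newton_coeff_eq_0: "k < j \<Longrightarrow> newton_coeff z y k j = 0"
  by (induction k arbitrary: j) auto

lemma newton_coeff_diag [simp]: "newton_coeff z y k k = 1"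
  by (induction k) (auto simp: newton_coeff_eq_0)

lemma newton_expansion:
  "(\<Prod>s<k. x - z s) = (\<Sum>j\<le>k. newton_coeff z y k j * (\<Prod>t<j. x - y t))"
proof (induction k)
  case (Suc k)
  let ?c = "newton_coeff z y k" and ?N = "\<lambda>j. \<Prod>t<j. x - y t"
  have "(\<Prod>s<Suc k. x - z s) = (\<Sum>j\<le>k. ?c j * ?N j) * (x - z k)"
    by (simp add: Suc.IH)
  also have "\<dots> = (\<Sum>j\<le>k. ?c j * ?N (Suc j) + (y j - z k) * ?c j * ?N j)"
    unfolding sum_distrib_right by (intro sum.cong refl) (simp add: algebra_simps)
  also have "\<dots> = (\<Sum>j\<le>k. ?c j * ?N (Suc j)) + (\<Sum>j\<le>Suc k. (y j - z k) * ?c j * ?N j)"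
    by (simp add: sum.distrib newton_coeff_eq_0)
  also have "(\<Sum>j\<le>k. ?c j * ?N (Suc j))
      = (\<Sum>j\<le>Suc k. (if j = 0 then 0 else ?c (j - 1)) * ?N j)"
    by (subst sum.atMost_Suc_shift) simp
  also have "\<dots> + (\<Sum>j\<le>Suc k. (y j - z k) * ?c j * ?N j)
      = (\<Sum>j\<le>Suc k. newton_coeff z y (Suc k) j * ?N j)"
    unfolding sum.distrib[symmetric] newton_coeff.simps(2)
    by (intro sum.cong refl) (simp only: distrib_right)
  finally show ?case .
qed auto

lemma newton_expansion_node:
  assumes "i < n"
  shows "(\<Prod>s<k. y i - z s) = (\<Sum>j<n. newton_coeff z y k j * (\<Prod>t<j. y i - y t))"
proof -
  have "(\<Prod>s<k. y i - z s) = (\<Sum>j\<le>k. newton_coeff z y k j * (\<Prod>t<j. y i - y t))"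
    by (rule newton_expansion)
  also have "\<dots> = (\<Sum>j\<in>{..k} \<union> {..<n}. newton_coeff z y k j * (\<Prod>t<j. y i - y t))"
    by (intro sum.mono_neutral_left) (auto simp: newton_coeff_eq_0)
  also have "\<dots> = (\<Sum>j<n. newton_coeff z y k j * (\<Prod>t<j. y i - y t))"
  proof (intro sum.mono_neutral_right ballI)
    fix j assume "j \<in> {..k} \<union> {..<n} - {..<n}"
    then have "i < j" using assms by auto
    then have "(\<Prod>t<j. y i - y t) = 0" by (intro prod_zero) auto
    then show "newton_coeff z y k j * (\<Prod>t<j. y i - y t) = 0" by simp
  qed auto
  finally show ?thesis .
qed

definition vandermonde :: "nat \<Rightarrow> (nat \<Rightarrow> int) \<Rightarrow> int" where
  "vandermonde n y = (\<Prod>k<n. \<Prod>t<k. y k - y t)"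

lemma prod_list_diag_mat: "A \<in> carrier_mat n n \<Longrightarrow> prod_list (diag_mat A) = (\<Prod>i<n. A $$ (i, i))"
  by (simp add: prod_list_diag_prod atLeast0LessThan)

text \<open>
  At the node \<open>y i\<close> the Newton polynomials of degree larger than \<open>i\<close> vanish, so the matrix of the
  alternant factors as a triangular matrix with determinant \<open>vandermonde n y\<close> times the
  matrix of Newton coefficients.
\<close>

lemma alternant_eq_vandermonde_mult:
  "alternant n z y r = vandermonde n y * det (mat n n (\<lambda>(j, k). newton_coeff z y (r k) j))"
proof -
  let ?N = "mat n n (\<lambda>(i, j). \<Prod>t<j. y i - y t)"
  let ?C = "mat n n (\<lambda>(j, k). newton_coeff z y (r k) j)"
  have "mat n n (\<lambda>(i, j). \<Prod>s<r j. y i - z s) = ?N * ?C"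
    by (intro eq_matI)
      (auto simp: scalar_prod_def newton_expansion_node atLeast0LessThan mult.commute
            intro!: sum.cong)
  then have "alternant n z y r = det ?N * det ?C"
    unfolding alternant_def by (simp add: det_mult[of _ n])
  also have "det ?N = vandermonde n y"
  proof (subst det_lower_triangular)
    show "?N $$ (i, j) = 0" if "i < j" "j < n" for i j
      using that by (auto intro!: prod_zero)
    show "prod_list (diag_mat ?N) = vandermonde n y"
      by (subst prod_list_diag_mat[of _ n]) (auto simp: vandermonde_def)
  qed auto
  finally show ?thesis .
qed

text \<open>
  The exponents \<open>0, \<dots>, n - 1, u, v\<close>. For \<open>z = 0\<close> the quotient of the alternant by the
  Vandermonde determinant is the Schur polynomial of a partition with at most two rows; the
  next lemma is its Jacobi-Trudi formula.
\<close>

definition two_row_exponents :: "nat \<Rightarrow> nat \<Rightarrow> nat \<Rightarrow> nat \<Rightarrow> nat" where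
  "two_row_exponents n u v j = (if j < n then j else if j = n then u else v)"

lemma det_two_by_two:
  fixes A :: "int mat"
  assumes "A \<in> carrier_mat 2 2"
  shows "det A = A $$ (0, 0) * A $$ (1, 1) - A $$ (0, 1) * A $$ (1, 0)"
proof -
  have U: "{0..<2} = {0, 1::nat}" by auto
  have perms: "{\<sigma>. \<sigma> permutes {0..<2::nat}} = {id, Transposition.transpose 0 1}"
    unfolding U by (auto simp: permutes_doubleton_iff)
  have ne: "id \<noteq> Transposition.transpose (0::nat) 1"
    by (metis id_apply transpose_apply_first zero_neq_one)
  show ?thesis
    unfolding det_def'[OF assms] perms using ne by (simp add: U sign_swap_id)
qed

lemma alternant_two_row:
  "alternant (n + 2) z y (two_row_exponents n u v) = vandermonde (n + 2) y *
     (newton_coeff z y u n * newton_coeff z y v (n + 1)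
       - newton_coeff z y u (n + 1) * newton_coeff z y v n)"
proof -
  let ?r = "two_row_exponents n u v"
  let ?C = "mat (n + 2) (n + 2) (\<lambda>(j, k). newton_coeff z y (?r k) j)"
  let ?A1 = "mat n n (\<lambda>(j, k). newton_coeff z y k j)"
  let ?A2 = "mat n 2 (\<lambda>(j, k). newton_coeff z y (?r (n + k)) j)"
  let ?A4 = "mat 2 2 (\<lambda>(j, k). newton_coeff z y (?r (n + k)) (n + j))"
  have "?C = four_block_mat ?A1 ?A2 (0\<^sub>m 2 n) ?A4"
    by (intro eq_matI) (auto simp: two_row_exponents_def newton_coeff_eq_0)
  then have "det ?C = det ?A1 * det ?A4"
    by (simp add: det_four_block_mat_lower_left_zero[of _ n _ 2])
  also have "det ?A1 = 1"
    by (subst det_upper_triangular[of _ n])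
      (auto simp: prod_list_diag_mat[of _ n] newton_coeff_eq_0 intro!: upper_triangularI)
  also have "det ?A4 = newton_coeff z y u n * newton_coeff z y v (n + 1)
       - newton_coeff z y u (n + 1) * newton_coeff z y v n"
    by (subst det_two_by_two) (auto simp: two_row_exponents_def)
  finally show ?thesis
    by (simp add: alternant_eq_vandermonde_mult)
qed

section \<open>Signed moments\<close>

definition flip_signs :: "nat set \<Rightarrow> (nat \<Rightarrow> int) \<Rightarrow> nat \<Rightarrow> int" where
  "flip_signs I a i = (if i \<in> I then - a i else a i)"

text \<open>
  An alternating sum over all choices of signs of the \<open>a i\<close>. The sum of \<open>flip_signs I a\<close> differs
  from the sum of \<open>a\<close> by twice the subset sum over \<open>I\<close>; hence for \<open>M = p - 1\<close> Fermat's theorem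
  turns the power into an indicator, modulo \<open>p\<close>, of the sets \<open>I\<close> for which it is nonzero.
\<close>

definition signed_moment :: "nat \<Rightarrow> (nat \<Rightarrow> int) \<Rightarrow> (nat \<Rightarrow> nat) \<Rightarrow> nat \<Rightarrow> int" where
  "signed_moment n a r M = (\<Sum>I\<in>Pow {..<n}.
     (- 1) ^ card I * (\<Sum>i<n. flip_signs I a i) ^ M * alternant n (\<lambda>_. 0) (flip_signs I a) r)"

lemma signed_moment_Suc:
  "signed_moment n a r (Suc M) = (\<Sum>j<n. signed_moment n a (r(j := Suc (r j))) M)"
proof -
  have "signed_moment n a r (Suc M) = (\<Sum>I\<in>Pow {..<n}. (- 1) ^ card I * (\<Sum>i<n. flip_signs I a i) ^ M *
          (((\<Sum>i<n. flip_signs I a i) - (\<Sum>j<n. 0)) * alternant n (\<lambda>_. 0) (flip_signs I a) r))"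
    unfolding signed_moment_def by (intro sum.cong) (auto simp: mult_ac)
  also have "\<dots> = (\<Sum>j<n. signed_moment n a (r(j := Suc (r j))) M)"
    unfolding alternant_step[where z = "\<lambda>_. 0"] signed_moment_def sum_distrib_left
    by (rule sum.swap)
  finally show ?thesis .
qed

text \<open>
  In every Leibniz term the sum over the signs factors into the differences
  \<open>a i ^ e - (- a i) ^ e\<close>, which kill the even exponents and double the odd ones.
\<close>

lemma signed_moment_0:
  "signed_moment n a r 0 = (if \<forall>j<n. odd (r j) then 2 ^ n * alternant n (\<lambda>_. 0) a r else 0)"
proof -
  have "signed_moment n a r 0 = (\<Sum>I\<in>Pow {..<n}. \<Sum>\<sigma> | \<sigma> permutes {..<n}.
          signof \<sigma> * ((- 1) ^ card I * (\<Prod>i<n. flip_signs I a i ^ r (\<sigma> i))))"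
    unfolding signed_moment_def alternant_altdef sum_distrib_left
    by (intro sum.cong refl) (simp add: mult_ac)
  also have "\<dots> = (\<Sum>\<sigma> | \<sigma> permutes {..<n}. signof \<sigma> *
          (\<Sum>I\<in>Pow {..<n}. (- 1) ^ card I * (\<Prod>i<n. flip_signs I a i ^ r (\<sigma> i))))"
    unfolding sum_distrib_left by (rule sum.swap)
  also have "\<dots> = (\<Sum>\<sigma> | \<sigma> permutes {..<n}.
      (if \<forall>j<n. odd (r j) then 2 ^ n else 0) * (signof \<sigma> * (\<Prod>i<n. a i ^ r (\<sigma> i))))"
  proof (intro sum.cong refl)
    fix \<sigma> assume "\<sigma> \<in> {\<sigma>. \<sigma> permutes {..<n}}"
    then have \<sigma>: "\<sigma> permutes {..<n}" by simp
    have "(\<Sum>I\<in>Pow {..<n}. (- 1) ^ card I * (\<Prod>i<n. flip_signs I a i ^ r (\<sigma> i)))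
        = (\<Sum>I\<in>Pow {..<n}. (- 1) ^ card I * (\<Prod>i\<in>I. (- a i) ^ r (\<sigma> i)) *
            (\<Prod>i\<in>{..<n} - I. a i ^ r (\<sigma> i)))"
    proof (intro sum.cong refl)
      fix I assume "I \<in> Pow {..<n}"
      then have I: "I \<subseteq> {..<n}" by simp
      have "(\<Prod>i<n. flip_signs I a i ^ r (\<sigma> i)) =
          (\<Prod>i\<in>{..<n} - I. flip_signs I a i ^ r (\<sigma> i)) * (\<Prod>i\<in>I. flip_signs I a i ^ r (\<sigma> i))"
        using I by (intro prod.subset_diff) auto
      also have "\<dots> = (\<Prod>i\<in>{..<n} - I. a i ^ r (\<sigma> i)) * (\<Prod>i\<in>I. (- a i) ^ r (\<sigma> i))"
        by (intro arg_cong2[where f = "(*)"] prod.cong) (auto simp: flip_signs_def)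
      finally show "(- 1) ^ card I * (\<Prod>i<n. flip_signs I a i ^ r (\<sigma> i)) =
          (- 1) ^ card I * (\<Prod>i\<in>I. (- a i) ^ r (\<sigma> i)) * (\<Prod>i\<in>{..<n} - I. a i ^ r (\<sigma> i))"
        by (simp add: mult_ac)
    qed
    also have "\<dots> = (\<Prod>i<n. a i ^ r (\<sigma> i) - (- a i) ^ r (\<sigma> i))"
      by (rule prod_diff_conv_sum[symmetric]) simp
    also have "\<dots> = (if \<forall>j<n. odd (r j) then 2 ^ n else 0) * (\<Prod>i<n. a i ^ r (\<sigma> i))"
    proof (cases "\<forall>j<n. odd (r j)")
      case True
      then have "odd (r (\<sigma> i))" if "i < n" for i
        using permutes_in_image[OF \<sigma>, of i] that by auto
      then have "(\<Prod>i<n. a i ^ r (\<sigma> i) - (- a i) ^ r (\<sigma> i)) = (\<Prod>i<n. 2 * a i ^ r (\<sigma> i))"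
        by (intro prod.cong) auto
      then show ?thesis using True by (simp add: prod.distrib)
    next
      case False
      then obtain j where j: "j < n" "even (r j)" by auto
      obtain i where "i < n" "\<sigma> i = j"
        using permutes_image[OF \<sigma>] j by (metis imageE lessThan_iff)
      then have "(\<Prod>i<n. a i ^ r (\<sigma> i) - (- a i) ^ r (\<sigma> i)) = 0"
        using j by (intro prod_zero) (auto intro!: bexI[of _ i])
      then show ?thesis using False by auto
    qed
    finally show "signof \<sigma> * (\<Sum>I\<in>Pow {..<n}. (- 1) ^ card I * (\<Prod>i<n. flip_signs I a i ^ r (\<sigma> i))) =
        (if \<forall>j<n. odd (r j) then 2 ^ n else 0) * (signof \<sigma> * (\<Prod>i<n. a i ^ r (\<sigma> i)))"
      by simp
  qed
  also have "\<dots> = (if \<forall>j<n. odd (r j) then 2 ^ n * alternant n (\<lambda>_. 0) a r else 0)"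
    unfolding alternant_altdef by (auto simp: sum_distrib_left)
  finally show ?thesis .
qed

definition odds :: "nat \<Rightarrow> nat" where
  "odds i = 2 * i + 1"

text \<open>
  The sparsest possible odd exponents are \<open>1, 3, 5, \<dots>\<close>; this bound is the source of the
  critical degree \<open>n ^ 2\<close> below.
\<close>

lemma odd_set_sum:
  fixes S :: "nat set"
  assumes "finite S" "\<And>x. x \<in> S \<Longrightarrow> odd x"
  shows "card S ^ 2 \<le> \<Sum>S" and "\<Sum>S = card S ^ 2 \<Longrightarrow> S = odds ` {..<card S}"
proof -
  have "card S ^ 2 \<le> \<Sum>S \<and> (\<Sum>S = card S ^ 2 \<longrightarrow> S = odds ` {..<card S})"
    using assms
  proof (induction S rule: finite_linorder_max_induct)
    case (insert b A)
    have "A \<subseteq> odds ` {..<b div 2}"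
    proof
      fix x assume "x \<in> A"
      moreover from this insert have "odd x" "x < b" "odd b" by auto
      ultimately show "x \<in> odds ` {..<b div 2}"
        by (intro image_eqI[of _ _ "x div 2"]) (auto elim!: oddE simp: odds_def)
    qed
    then have "card A \<le> card (odds ` {..<b div 2})"
      by (intro card_mono) auto
    also have "\<dots> = b div 2" by (subst card_image) (auto simp: inj_on_def odds_def)
    finally have b: "2 * card A + 1 \<le> b" using insert.prems[of b] by (simp, presburger)
    have "b \<notin> A" using insert.hyps by auto
    then have c: "card (insert b A) = Suc (card A)" and s: "\<Sum>(insert b A) = b + \<Sum>A"
      using insert.hyps by auto
    have IH: "card A ^ 2 \<le> \<Sum>A" "\<Sum>A = card A ^ 2 \<Longrightarrow> A = odds ` {..<card A}"
      using insert by auto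
    have sq: "Suc (card A) ^ 2 = card A ^ 2 + (2 * card A + 1)"
      by (simp add: power2_eq_square)
    have "insert b A = odds ` {..<Suc (card A)}" if "b + \<Sum>A = Suc (card A) ^ 2"
    proof -
      from that have "b = odds (card A)" "\<Sum>A = card A ^ 2"
        using b IH(1) sq by (simp_all add: odds_def)
      then show ?thesis using IH(2) by (simp add: lessThan_Suc)
    qed
    then show ?case using b IH(1) sq unfolding c s by simp
  qed auto
  then show "card S ^ 2 \<le> \<Sum>S" "\<Sum>S = card S ^ 2 \<Longrightarrow> S = odds ` {..<card S}"
    by auto
qed

text \<open>
  Each of the \<open>M\<close> factors raises one exponent by one. A term that survives the sum over signs
  must end with odd exponents, and with distinct ones by antisymmetry, so the final
  exponent sum is at least \<open>n ^ 2\<close>.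
\<close>

lemma signed_moment_eq_0:
  assumes "(\<Sum>j<n. r j) + M < n ^ 2"
  shows "signed_moment n a r M = 0"
  using assms
proof (induction M arbitrary: r)
  case 0
  have "alternant n (\<lambda>_. 0) a r = 0" if odd: "\<forall>j<n. odd (r j)"
  proof (cases "inj_on r {..<n}")
    case True
    have "card (r ` {..<n}) ^ 2 \<le> \<Sum>(r ` {..<n})"
      using odd by (intro odd_set_sum) auto
    with True 0 show ?thesis by (simp add: card_image sum.reindex)
  next
    case False
    then show ?thesis unfolding inj_on_def by (auto intro: alternant_eq_0)
  qed
  then show ?case by (simp add: signed_moment_0)
next
  case (Suc M)
  have "signed_moment n a (r(j := Suc (r j))) M = 0" if "j < n" for j
  proof (rule Suc.IH)
    have "(\<Sum>i<n. (r(j := Suc (r j))) i) = (\<Sum>i<n. r i + (if i = j then 1 else 0))"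
      by (intro sum.cong) auto
    also have "\<dots> = (\<Sum>i<n. r i) + 1" using that by (simp add: sum.distrib)
    finally show "(\<Sum>i<n. (r(j := Suc (r j))) i) + M < n ^ 2" using Suc.prems by simp
  qed
  then show ?case by (simp add: signed_moment_Suc)
qed

text \<open>
  In the critical degree only the final exponents \<open>1, 3, \<dots>, 2 n - 1\<close> survive, and the moment is
  their alternant times the signed number of ways in which \<open>M\<close> unit steps lead there from
  \<open>r\<close>. Up to factorials that number is an alternant of falling factorials evaluated at the
  odd numbers, because both satisfy the recursion of \<open>alternant_step\<close>.
\<close>

abbreviation falling_alternant :: "nat \<Rightarrow> (nat \<Rightarrow> nat) \<Rightarrow> int" where
  "falling_alternant n r \<equiv> alternant n int (\<lambda>i. int (odds i)) r"

lemma falling_eq_0: "l < k \<Longrightarrow> (\<Prod>s<k. int l - int s) = 0"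
  by (intro prod_zero) auto

lemma falling_self: "(\<Prod>s<k. int k - int s) = fact k"
proof -
  have "(\<Prod>s<k. int k - int s) = (\<Prod>s<k. int (Suc s))"
    by (subst prod.nat_diff_reindex[symmetric]) (intro prod.cong, auto simp: of_nat_diff)
  also have "\<dots> = int (fact k)"
    by (simp only: fact_prod_Suc of_nat_prod atLeast0LessThan of_nat_id)
  finally show ?thesis by simp
qed

lemma falling_alternant_odds: "falling_alternant n odds = (\<Prod>i<n. fact (odds i))"
  unfolding alternant_def
proof (subst det_lower_triangular)
  show "mat n n (\<lambda>(i, j). \<Prod>s<odds j. int (odds i) - int s) $$ (i, j) = 0"
    if "i < j" "j < n" for i j
    using that falling_eq_0[of "odds i" "odds j"] by (simp add: odds_def)
  show "prod_list (diag_mat (mat n n (\<lambda>(i, j). \<Prod>s<odds j. int (odds i) - int s)))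
      = (\<Prod>i<n. fact (odds i))"
    by (subst prod_list_diag_mat[of _ n])
      (auto simp: falling_self)
qed auto

lemma sum_odds: "(\<Sum>i<n. odds i) = n ^ 2"
  by (induction n) (auto simp: power2_eq_square odds_def)

text \<open>
  The case without steps. If \<open>r\<close> is a permutation of the odd numbers, both sides carry its sign.
  Otherwise the right-hand side vanishes as well: a nonzero Leibniz term of the
  falling alternant needs every exponent to be at most its node, and as the totals agree, equal
  to it.
\<close>

lemma signed_moment_top_aux:
  assumes "(\<Sum>j<n. r j) = n ^ 2"
  shows "(\<Prod>i<n. fact (odds i)) * (if \<forall>j<n. odd (r j) then alternant n (\<lambda>_. 0) a r else 0) =
    alternant n (\<lambda>_. 0) a odds * falling_alternant n r"
proof (cases "inj_on r {..<n}")
  case False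
  then obtain i j where "i < n" "j < n" "i \<noteq> j" "r i = r j" unfolding inj_on_def by auto
  then show ?thesis by (auto simp: alternant_eq_0[of i n j])
next
  case inj: True
  show ?thesis
  proof (cases "\<forall>j<n. odd (r j)")
    case True
    have img: "r ` {..<n} = odds ` {..<n}"
    proof -
      have card: "card (r ` {..<n}) = n" using inj by (simp add: card_image)
      have "r ` {..<n} = odds ` {..<card (r ` {..<n})}"
        by (rule odd_set_sum(2)) (use True assms inj in \<open>auto simp: card sum.reindex\<close>)
      then show ?thesis unfolding card .
    qed
    define \<pi> where "\<pi> j = (if j < n then r j div 2 else j)" for j
    have r\<pi>: "r j = odds (\<pi> j)" if "j < n" for j
      using that True by (auto simp: \<pi>_def odds_def elim!: oddE)
    have "\<pi> permutes {..<n}"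
    proof (rule bij_imp_permutes)
      have "inj_on \<pi> {..<n}" using inj r\<pi> by (auto simp: inj_on_def)
      moreover have "\<pi> ` {..<n} \<subseteq> {..<n}"
      proof safe
        fix j assume "j < n"
        then have "r j \<in> odds ` {..<n}" using img by blast
        then show "\<pi> j < n" using r\<pi>[OF \<open>j < n\<close>] by (auto simp: odds_def)
      qed
      ultimately show "bij_betw \<pi> {..<n} {..<n}"
        by (auto simp: bij_betw_def endo_inj_surj)
    qed (auto simp: \<pi>_def)
    moreover have "alternant n z y r = alternant n z y (odds \<circ> \<pi>)" for z y
      by (rule alternant_cong) (auto simp: r\<pi>)
    ultimately have "alternant n z y r = signof \<pi> * alternant n z y odds" for z y
      by (simp only: alternant_permute)
    then show ?thesis using True by (simp add: falling_alternant_odds)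
  next
    case False
    have "(\<Prod>i<n. \<Prod>s<r (\<sigma> i). int (odds i) - int s) = 0" if \<sigma>: "\<sigma> permutes {..<n}" for \<sigma>
    proof -
      have "\<exists>i<n. odds i < r (\<sigma> i)"
      proof (rule ccontr)
        assume "\<not> (\<exists>i<n. odds i < r (\<sigma> i))"
        then have le: "r (\<sigma> i) \<le> odds i" if "i < n" for i using that by force
        have "(\<Sum>i<n. r (\<sigma> i)) = (\<Sum>i<n. odds i)"
          using sum.permute[OF \<sigma>, of r] assms sum_odds[of n] by (simp add: o_def)
        then have eq: "r (\<sigma> i) = odds i" if "i < n" for i
          using sum_mono_inv[of "\<lambda>i. r (\<sigma> i)" "{..<n}" odds i] le that by auto
        have "odd (r j)" if "j < n" for j
        proof -
          obtain i where "i < n" "\<sigma> i = j"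
            using permutes_image[OF \<sigma>] \<open>j < n\<close> by (metis imageE lessThan_iff)
          with eq[of i] show ?thesis by (simp add: odds_def)
        qed
        with False show False by simp
      qed
      then show ?thesis by (intro prod_zero) (auto intro: falling_eq_0)
    qed
    then have "falling_alternant n r = 0" unfolding alternant_altdef by (intro sum.neutral) auto
    then show ?thesis using False by auto
  qed
qed

lemma signed_moment_top:
  assumes "(\<Sum>j<n. r j) + M = n ^ 2"
  shows "(\<Prod>i<n. fact (odds i)) * signed_moment n a r M =
    2 ^ n * alternant n (\<lambda>_. 0) a odds * fact M * falling_alternant n r"
  using assms
proof (induction M arbitrary: r)
  case 0
  have "(\<Prod>i<n. fact (odds i)) * signed_moment n a r 0 =
      2 ^ n * ((\<Prod>i<n. fact (odds i)) * (if \<forall>j<n. odd (r j) then alternant n (\<lambda>_. 0) a r else 0))"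
    unfolding signed_moment_0 by (auto simp only: mult_zero_right if_True if_False mult_ac split: if_split)
  also have "\<dots> = 2 ^ n * (alternant n (\<lambda>_. 0) a odds * falling_alternant n r)"
    using 0 by (subst signed_moment_top_aux) auto
  finally show ?case by simp
next
  case (Suc M)
  let ?c = "2 ^ n * alternant n (\<lambda>_. 0) a odds * fact M"
  have IH: "(\<Prod>i<n. fact (odds i)) * signed_moment n a (r(j := Suc (r j))) M =
      ?c * falling_alternant n (r(j := Suc (r j)))" if "j < n" for j
  proof (rule Suc.IH)
    have "(\<Sum>i<n. (r(j := Suc (r j))) i) = (\<Sum>i<n. r i + (if i = j then 1 else 0))"
      by (intro sum.cong) auto
    also have "\<dots> = (\<Sum>i<n. r i) + 1" using that by (simp add: sum.distrib)
    finally show "(\<Sum>i<n. (r(j := Suc (r j))) i) + M = n ^ 2" using Suc.prems by simp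
  qed
  have "(\<Prod>i<n. fact (odds i)) * signed_moment n a r (Suc M) =
      (\<Sum>j<n. ?c * falling_alternant n (r(j := Suc (r j))))"
    unfolding signed_moment_Suc sum_distrib_left by (intro sum.cong refl IH) auto
  also have "\<dots> = ?c * (((\<Sum>i<n. int (odds i)) - (\<Sum>j<n. int (r j))) * falling_alternant n r)"
    unfolding alternant_step by (simp add: sum_distrib_left)
  also have "(\<Sum>i<n. int (odds i)) - (\<Sum>j<n. int (r j)) = int (Suc M)"
  proof -
    have "int (\<Sum>i<n. odds i) - int (\<Sum>j<n. r j) = int (Suc M)"
      unfolding sum_odds using Suc.prems by linarith
    then show ?thesis by (simp only: of_nat_sum)
  qed
  finally show ?case by (simp add: mult_ac)
qed

section \<open>The coefficient modulo the prime\<close>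

text \<open>
  Falling factorials have product-form Newton coefficients at the nodes \<open>1, 3, 5, \<dots>\<close>: since
  \<open>(1 + t) ^ x\<close> generates them, the coefficient is read off from \<open>(1 + t) * (2 + t) ^ j\<close>. (These
  are the coefficients of the Bessel polynomials.) The proof is by the recursion instead.
\<close>

lemma newton_coeff_falling_odds:
  assumes "j \<le> k" "k \<le> 2 * j + 1"
  shows "newton_coeff int (\<lambda>i. int (odds i)) k j *
           (2 ^ (k - j) * fact (k - j) * fact (2 * j + 1 - k)) = fact (k + 1)"
proof -
  let ?c = "newton_coeff int (\<lambda>i. int (odds i))"
  \<comment> \<open>The vanishing beyond \<open>2 * j + 1\<close> feeds the boundary case \<open>k = 2 * j\<close> of the recursion.\<close>
  have "(2 * j + 1 < k \<longrightarrow> ?c k j = 0) \<and>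
     (j \<le> k \<longrightarrow> k \<le> 2 * j + 1 \<longrightarrow>
        ?c k j * (2 ^ (k - j) * fact (k - j) * fact (2 * j + 1 - k)) = fact (k + 1))" for k j
  proof (induction k arbitrary: j)
    case (Suc k)
    show ?case
    proof (intro conjI impI)
      assume *: "2 * j + 1 < Suc k"
      have "?c k (j - 1) = 0" if "j > 0" using Suc.IH[of "j - 1"] that * by auto
      moreover have "(int (odds j) - int k) * ?c k j = 0"
        using Suc.IH[of j] * by (cases "k = 2 * j + 1") (auto simp: odds_def)
      ultimately show "?c (Suc k) j = 0" by auto
    next
      assume *: "j \<le> Suc k" "Suc k \<le> 2 * j + 1"
      show "?c (Suc k) j * (2 ^ (Suc k - j) * fact (Suc k - j) * fact (2 * j + 1 - Suc k)) = fact (Suc k + 1)"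
      proof (cases "j = Suc k")
        case True
        then show ?thesis by (simp del: newton_coeff.simps)
      next
        case False
        define s where "s = k - j"
        define t where "t = 2 * j - k"
        have k: "k = j + s" "j = t + s" using False * by (auto simp: s_def t_def)
        have A: "?c k j * (2 ^ s * fact s * fact (Suc t)) = fact (k + 1)"
          using Suc.IH[of j] k by (simp del: newton_coeff.simps)
        have B: "(if j = 0 then 0 else ?c k (j - 1)) * (2 ^ Suc s * fact (Suc s) * fact t) = int t * fact (k + 1)"
        proof (cases "t = 0")
          case True
          then show ?thesis using Suc.IH[of "j - 1"] k by auto
        next
          case False
          then obtain t' where t: "t = Suc t'" by (cases t) auto
          then obtain j' where j: "j = Suc j'" using k by (cases j) auto
          have "?c k j' * (2 ^ (k - j') * fact (k - j') * fact (2 * j' + 1 - k)) = fact (k + 1)"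
            using Suc.IH[of j'] k t j by (simp del: newton_coeff.simps)
          moreover have "k - j' = Suc s" "2 * j' + 1 - k = t'" using k t j by auto
          ultimately have "?c k j' * (2 ^ Suc s * fact (Suc s) * fact t') = fact (k + 1)"
            by (simp only:)
          moreover have "?c k j' * (2 ^ Suc s * fact (Suc s) * fact (Suc t')) =
              int (Suc t') * (?c k j' * (2 ^ Suc s * fact (Suc s) * fact t'))"
            by (simp only: fact_Suc[of t'] of_nat_id mult_ac)
          ultimately show ?thesis unfolding t j by (simp del: newton_coeff.simps fact_Suc)
        qed
        have e: "int (odds j) - int k = int (Suc t)" using k by (simp add: odds_def)
        have "?c (Suc k) j * (2 ^ Suc s * fact (Suc s) * fact t) =
          (if j = 0 then 0 else ?c k (j - 1)) * (2 ^ Suc s * fact (Suc s) * fact t) +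
          2 * int (Suc s) * (?c k j * (2 ^ s * fact s * (int (Suc t) * fact t)))"
          unfolding newton_coeff.simps e by (simp add: algebra_simps)
        also have "int (Suc t) * fact t = fact (Suc t)" by simp
        also have "(if j = 0 then 0 else ?c k (j - 1)) * (2 ^ Suc s * fact (Suc s) * fact t) +
          2 * int (Suc s) * (?c k j * (2 ^ s * fact s * fact (Suc t))) = int (t + 2 * Suc s) * fact (k + 1)"
          unfolding A B by (simp add: algebra_simps)
        also have "t + 2 * Suc s = Suc (k + 1)" using k by simp
        also have "int (Suc (k + 1)) * fact (k + 1) = fact (Suc k + 1)" by simp
        finally show ?thesis using k by (simp add: Suc_diff_le)
      qed
    qed
  qed auto
  then show ?thesis using assms by blast
qed

text \<open>
  With \<open>d = n + 2\<close> this is the minor that belongs to the exponents \<open>0, \<dots>, d - 3, d + 1, d - 1 + m\<close>,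
  that is, to the two-row partition \<open>(m, 3)\<close>. The point of the formula is its last factor: although
  the minor is a difference of two products, it factors up to \<open>d * (d + 1) - 3 * m - 3\<close>, which is
  \<open>1 - m\<close> modulo \<open>p\<close> when \<open>d * (d + 1) = 2 * (p + m + 2)\<close>. So the minor is a unit modulo \<open>p\<close>.
\<close>

lemma falling_minor:
  fixes n m :: nat
  assumes "2 \<le> n" "m < n"
  defines "c \<equiv> newton_coeff int (\<lambda>i. int (odds i))"
  shows "(c (n + 3) n * c (n + 1 + m) (n + 1) - c (n + 3) (n + 1) * c (n + 1 + m) n) *
           (48 * 2 ^ m * fact (m + 1) * fact n * fact (n + 2 - m)) =
         fact (n + 4) * fact (n + 2 + m) *
           ((int m - 2) * (int ((n + 2) * (n + 3)) - 3 * int m - 3))"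
proof -
  obtain n' where n': "n = n' + 2" using assms(1) by (metis add.commute le_Suc_ex)
  obtain e where e: "n = m + Suc e" using assms(2) less_imp_Suc_add by auto
  have 1: "c (n + 3) n * (48 * fact n') = fact (n + 4)"
    using newton_coeff_falling_odds[of n "n + 3"]
    by (simp add: c_def n' fact_numeral numeral_eq_Suc del: newton_coeff.simps fact_Suc of_nat_Suc)
       (simp add: numeral_eq_Suc)
  have 2: "c (n + 1 + m) (n + 1) * (2 ^ m * fact m * fact (e + 3)) = fact (n + 2 + m)"
    using newton_coeff_falling_odds[of "n + 1" "n + 1 + m"] assms(2)
    by (simp add: c_def e del: newton_coeff.simps fact_Suc of_nat_Suc)
  have 3: "c (n + 3) (n + 1) * (8 * fact n) = fact (n + 4)"
    using newton_coeff_falling_odds[of "n + 1" "n + 3"] assms(1)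
    by (simp add: c_def n' del: newton_coeff.simps fact_Suc of_nat_Suc)
  have 4: "c (n + 1 + m) n * (2 * 2 ^ m * fact (m + 1) * fact (e + 1)) = fact (n + 2 + m)"
    using newton_coeff_falling_odds[of n "n + 1 + m"] assms(2)
    by (simp add: c_def e del: newton_coeff.simps fact_Suc of_nat_Suc)
  have n: "fact n = int (n' + 2) * int (n' + 1) * fact n'"
    unfolding n' by (simp add: algebra_simps numeral_eq_Suc)
  have e': "fact (e + 3) = int (e + 3) * int (e + 2) * fact (e + 1)"
    by (simp add: algebra_simps numeral_eq_Suc)
  have m: "fact (m + 1) = int (m + 1) * fact m" by simp
  have "c (n + 3) n * c (n + 1 + m) (n + 1) * (48 * 2 ^ m * fact (m + 1) * fact n * fact (e + 3))
      = (c (n + 3) n * (48 * fact n')) * (c (n + 1 + m) (n + 1) * (2 ^ m * fact m * fact (e + 3)))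
        * (int (n' + 2) * int (n' + 1) * int (m + 1))"
    unfolding n m by (simp only: mult_ac)
  also have "\<dots> = fact (n + 4) * fact (n + 2 + m) * (int (n' + 2) * int (n' + 1) * int (m + 1))"
    unfolding 1 2 ..
  finally have P: "c (n + 3) n * c (n + 1 + m) (n + 1) * (48 * 2 ^ m * fact (m + 1) * fact n * fact (e + 3))
      = \<dots>" .
  have "c (n + 3) (n + 1) * c (n + 1 + m) n * (48 * 2 ^ m * fact (m + 1) * fact n * fact (e + 3))
      = (c (n + 3) (n + 1) * (8 * fact n)) * (c (n + 1 + m) n * (2 * 2 ^ m * fact (m + 1) * fact (e + 1)))
        * (3 * int (e + 3) * int (e + 2))"
    unfolding e' by simp
  also have "\<dots> = fact (n + 4) * fact (n + 2 + m) * (3 * int (e + 3) * int (e + 2))"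
    unfolding 3 4 ..
  finally have Q: "c (n + 3) (n + 1) * c (n + 1 + m) n * (48 * 2 ^ m * fact (m + 1) * fact n * fact (e + 3))
      = \<dots>" .
  have r: "int (n' + 2) * int (n' + 1) * int (m + 1) - 3 * int (e + 3) * int (e + 2)
      = (int m - 2) * (int ((n + 2) * (n + 3)) - 3 * int m - 3)"
  proof -
    have n'': "int n' = int m + int e - 1" using n' e by linarith
    show ?thesis unfolding e of_nat_add of_nat_mult n'' by (simp add: algebra_simps)
  qed
  have "n + 2 - m = e + 3" using e by simp
  then have "(c (n + 3) n * c (n + 1 + m) (n + 1) - c (n + 3) (n + 1) * c (n + 1 + m) n) *
      (48 * 2 ^ m * fact (m + 1) * fact n * fact (n + 2 - m)) = fact (n + 4) * fact (n + 2 + m) *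
        (int (n' + 2) * int (n' + 1) * int (m + 1) - 3 * int (e + 3) * int (e + 2))"
    unfolding left_diff_distrib right_diff_distrib by (simp only: P Q)
  then show ?thesis unfolding r .
qed

section \<open>Arithmetic modulo a prime\<close>

lemma alternant_initial: "alternant n z y (\<lambda>j. j) = vandermonde n y"
proof -
  have "det (mat n n (\<lambda>(j, k). newton_coeff z y k j)) = 1"
    by (subst det_upper_triangular[of _ n])
      (auto simp: prod_list_diag_mat[of _ n] newton_coeff_eq_0 intro!: upper_triangularI)
  then show ?thesis by (simp add: alternant_eq_vandermonde_mult)
qed

lemma alternant_odds:
  "alternant n (\<lambda>_. 0) a odds = (\<Prod>i<n. a i) * vandermonde n (\<lambda>i. a i ^ 2)"
proof -
  have "alternant n (\<lambda>_. 0) a odds = (\<Prod>i<n. a i) * alternant n (\<lambda>_. 0) (\<lambda>i. a i ^ 2) (\<lambda>j. j)"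
    unfolding alternant_altdef sum_distrib_left
    by (intro sum.cong refl) (simp add: odds_def prod.distrib power_mult)
  then show ?thesis by (simp add: alternant_initial)
qed

lemma alternant_uminus:
  "alternant n (\<lambda>_. 0) (\<lambda>i. - a i) r = (- 1) ^ (\<Sum>j<n. r j) * alternant n (\<lambda>_. 0) a r"
  unfolding alternant_altdef sum_distrib_left
proof (intro sum.cong refl)
  fix \<sigma> assume "\<sigma> \<in> {\<sigma>. \<sigma> permutes {..<n}}"
  then have "(\<Sum>j<n. r j) = (\<Sum>i<n. r (\<sigma> i))"
    using sum.permute[of \<sigma> "{..<n}" r] by (simp add: o_def)
  moreover have "(\<Prod>i<n. (- a i) ^ r (\<sigma> i)) = (\<Prod>i<n. (- 1) ^ r (\<sigma> i) * a i ^ r (\<sigma> i))"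
    by (intro prod.cong refl) (rule power_minus)
  ultimately show "signof \<sigma> * (\<Prod>i<n. \<Prod>s<r (\<sigma> i). - a i - 0) =
      (- 1) ^ (\<Sum>j<n. r j) * (signof \<sigma> * (\<Prod>i<n. \<Prod>s<r (\<sigma> i). a i - 0))"
    by (simp add: prod.distrib power_sum)
qed

lemma prime_not_dvd_vandermonde:
  fixes P :: int
  assumes "prime P" "\<And>i j. i < j \<Longrightarrow> j < n \<Longrightarrow> \<not> P dvd y j - y i"
  shows "\<not> P dvd vandermonde n y"
  using assms unfolding vandermonde_def by (auto simp: prime_dvd_prod_iff)

lemma fermat_int:
  fixes x :: int
  assumes "prime p" "\<not> int p dvd x"
  shows "int p dvd x ^ (p - 1) - 1"
proof -
  have p: "p > 0" using assms(1) by (simp add: prime_gt_0_nat)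
  define y where "y = nat (x mod int p)"
  have y: "int y = x mod int p" using p by (simp add: y_def)
  then have "\<not> p dvd y"
    using assms(2) by (metis int_dvd_int_iff dvd_mod_iff dvd_refl)
  then have "[y ^ (p - 1) = 1] (mod p)" using assms(1) by (rule fermat_theorem[rotated])
  then have "[int y ^ (p - 1) = 1] (mod int p)"
    by (metis cong_int_iff of_nat_1 of_nat_power)
  moreover have "[int y ^ (p - 1) = x ^ (p - 1)] (mod int p)"
    unfolding y by (intro cong_pow) simp
  ultimately show ?thesis
    by (metis cong_iff_dvd_diff cong_sym cong_trans)
qed

lemma sum_flip_signs:
  assumes "I \<subseteq> {..<n}"
  shows "(\<Sum>i<n. flip_signs I a i) = (\<Sum>i<n. a i) - 2 * (\<Sum>i\<in>I. a i)"
proof -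
  have "(\<Sum>i<n. flip_signs I a i) = (\<Sum>i<n. a i - (if i \<in> I then 2 * a i else 0))"
    by (intro sum.cong) (auto simp: flip_signs_def)
  also have "\<dots> = (\<Sum>i<n. a i) - (\<Sum>i\<in>{..<n} \<inter> I. 2 * a i)"
    by (simp add: sum_subtractf sum.inter_restrict)
  also have "{..<n} \<inter> I = I" using assms by auto
  finally show ?thesis by (simp add: sum_distrib_left)
qed

lemma prime_odd_dvd_twice:
  fixes x :: int
  assumes "prime p" "odd p"
  shows "int p dvd 2 * x \<longleftrightarrow> int p dvd x"
proof -
  have "\<not> int p dvd 2"
  proof
    assume "int p dvd 2"
    then have "p dvd 2" by (metis int_dvd_int_iff of_nat_numeral)
    then have "p \<le> 2" by (auto dest: dvd_imp_le)
    with assms show False using prime_ge_2_nat[of p] by auto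
  qed
  then show ?thesis using assms(1) by (simp add: prime_dvd_mult_iff)
qed

definition zero_sum_free_family :: "nat \<Rightarrow> nat \<Rightarrow> (nat \<Rightarrow> int) \<Rightarrow> bool" where
  "zero_sum_free_family p n a \<longleftrightarrow>
     (\<forall>I\<subseteq>{..<n}. I \<noteq> {} \<longrightarrow> \<not> int p dvd (\<Sum>i\<in>I. a i))"

definition distinct_mod :: "nat \<Rightarrow> nat \<Rightarrow> (nat \<Rightarrow> int) \<Rightarrow> bool" where
  "distinct_mod p n a \<longleftrightarrow> (\<forall>i<n. \<forall>j<n. i \<noteq> j \<longrightarrow> \<not> int p dvd a i - a j)"

lemma sum_initial: "2 * (\<Sum>j<n. j) + n = n * n" for n :: nat
  by (induction n) auto

section \<open>Zero-sum free sets\<close>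

text \<open>
  This determines the Olson constant of a group of prime order (a theorem of Balandraud).
  Let \<open>S\<close> be the sum of all \<open>a i\<close>. The power \<open>((\<Sum>i<n. flip_signs I a i) - S) ^ (p - 1)\<close> is \<open>0\<close>
  modulo \<open>p\<close> for \<open>I = {}\<close> and \<open>1\<close> otherwise. Expanded by the binomial theorem, its alternating sum
  against the Vandermonde alternant consists of signed moments of degree at most
  \<open>n * (n - 1) / 2 + p - 1\<close>. If \<open>n * (n + 1) \<ge> 2 * p\<close> this is below \<open>n ^ 2\<close>, everything vanishes
  except the missing term for \<open>I = {}\<close>, and the Vandermonde determinant would be divisible
  by \<open>p\<close>.
\<close>

lemma zero_sum_free_bound:
  assumes p: "prime p" "odd p"
    and free: "zero_sum_free_family p n a" and distinct: "distinct_mod p n a"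
  shows "n * (n + 1) < 2 * p"
proof (rule ccontr)
  assume "\<not> n * (n + 1) < 2 * p"
  then have large: "2 * p \<le> n * n + n" by simp
  have p0: "p > 0" using p by (simp add: prime_gt_0_nat)
  then have n0: "n > 0" using large by (cases n) auto
  define S where "S = (\<Sum>i<n. a i)"
  let ?alt = "\<lambda>I. alternant n (\<lambda>_. 0) (flip_signs I a) (\<lambda>j. j)"
  define E where "E = (\<Sum>I\<in>Pow {..<n}. (- 1) ^ card I * ((\<Sum>i<n. flip_signs I a i) - S) ^ (p - 1) * ?alt I)"
  have "E = (\<Sum>k\<le>p - 1. int (p - 1 choose k) * (- S) ^ (p - 1 - k) * signed_moment n a (\<lambda>j. j) k)"
  proof -
    have "E = (\<Sum>I\<in>Pow {..<n}. \<Sum>k\<le>p - 1. int (p - 1 choose k) * (- S) ^ (p - 1 - k) *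
            ((- 1) ^ card I * (\<Sum>i<n. flip_signs I a i) ^ k * ?alt I))"
      unfolding E_def diff_conv_add_uminus binomial_ring
      by (intro sum.cong refl) (simp add: sum_distrib_left sum_distrib_right mult_ac)
    then show ?thesis
      unfolding signed_moment_def sum_distrib_left by (subst (asm) sum.swap)
  qed
  also have "\<dots> = 0"
  proof (intro sum.neutral ballI)
    fix k assume "k \<in> {..p - 1}"
    then have "2 * ((\<Sum>j<n. j) + k) < 2 * (n * n)"
      using sum_initial[of n] large p0 by simp
    then have "(\<Sum>j<n. j) + k < n ^ 2" by (simp add: power2_eq_square)
    then show "int (p - 1 choose k) * (- S) ^ (p - 1 - k) * signed_moment n a (\<lambda>j. j) k = 0"
      by (simp add: signed_moment_eq_0)
  qed
  finally have E: "E = 0" .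
  have "signed_moment n a (\<lambda>j. j) 0 = 0"
  proof (rule signed_moment_eq_0)
    have "2 * (\<Sum>j<n. j) < 2 * (n * n)" using sum_initial[of n] n0 by simp
    then show "(\<Sum>j<n. j) + 0 < n ^ 2" by (simp add: power2_eq_square)
  qed
  then have M: "(\<Sum>I\<in>Pow {..<n}. (- 1) ^ card I * ?alt I) = 0"
    by (simp add: signed_moment_def)
  have "int p dvd (\<Sum>I\<in>Pow {..<n}. (- 1) ^ card I * ((\<Sum>i<n. flip_signs I a i) - S) ^ (p - 1) * ?alt I
      - (if I = {} then 0 else (- 1) ^ card I * ?alt I))"
  proof (intro dvd_sum)
    fix I assume "I \<in> Pow {..<n}"
    then have I: "I \<subseteq> {..<n}" by simp
    have s: "(\<Sum>i<n. flip_signs I a i) - S = - (2 * (\<Sum>i\<in>I. a i))"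
      using sum_flip_signs[OF I] by (simp add: S_def)
    show "int p dvd (- 1) ^ card I * ((\<Sum>i<n. flip_signs I a i) - S) ^ (p - 1) * ?alt I
      - (if I = {} then 0 else (- 1) ^ card I * ?alt I)"
    proof (cases "I = {}")
      case True
      have "p - 1 > 0" using p prime_gt_1_nat by force
      then show ?thesis using s True by (simp add: zero_power)
    next
      case False
      have "\<not> int p dvd (\<Sum>i<n. flip_signs I a i) - S"
        unfolding s using prime_odd_dvd_twice[OF p] free I False
        by (auto simp: zero_sum_free_family_def)
      then have "int p dvd ((\<Sum>i<n. flip_signs I a i) - S) ^ (p - 1) - 1"
        by (rule fermat_int[OF p(1)])
      then have "int p dvd ((- 1) ^ card I * ?alt I) * (((\<Sum>i<n. flip_signs I a i) - S) ^ (p - 1) - 1)"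
        by (rule dvd_mult)
      then show ?thesis using False by (simp add: algebra_simps)
    qed
  qed
  also have "(\<Sum>I\<in>Pow {..<n}. (- 1) ^ card I * ((\<Sum>i<n. flip_signs I a i) - S) ^ (p - 1) * ?alt I
      - (if I = {} then 0 else (- 1) ^ card I * ?alt I))
      = E - (\<Sum>I\<in>Pow {..<n}. if I = {} then 0 else (- 1) ^ card I * ?alt I)"
    unfolding E_def by (rule sum_subtractf)
  also have "(\<Sum>I\<in>Pow {..<n}. if I = {} then 0 else (- 1) ^ card I * ?alt I)
      = (\<Sum>I\<in>Pow {..<n}. (- 1) ^ card I * ?alt I) - ?alt {}"
    by (subst (2) sum.remove[of _ "{}"], simp, simp, subst sum.remove[of _ "{}"])
       (auto intro!: sum.cong)
  also have "?alt {} = vandermonde n a"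
    by (simp add: flip_signs_def[abs_def] alternant_initial)
  finally have "int p dvd vandermonde n a" using E M by simp
  then show False
    using prime_not_dvd_vandermonde[of "int p" n a] p distinct
    by (auto simp: distinct_mod_def)
qed

definition minimal_zero_sum_family :: "nat \<Rightarrow> nat \<Rightarrow> (nat \<Rightarrow> int) \<Rightarrow> bool" where
  "minimal_zero_sum_family p n a \<longleftrightarrow>
     (\<forall>I\<subseteq>{..<n}. int p dvd (\<Sum>i\<in>I. a i) \<longleftrightarrow> I = {} \<or> I = {..<n})"

section \<open>Minimal zero-sum sets of critical size\<close>

text \<open>
  The same idea, but now the signed sum vanishes modulo \<open>p\<close> for exactly two choices of signs, all
  plus and all minus. Against the constant \<open>1\<close> the alternating sum is zero for degree reasons, so
  the moment of order \<open>p - 1\<close> is the negative of the two missing terms.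
\<close>

lemma signed_moment_minimal:
  assumes p: "prime p" "odd p" and minimal: "minimal_zero_sum_family p n a"
    and n: "n > 0" and r: "(\<Sum>j<n. r j) < n ^ 2"
  shows "int p dvd signed_moment n a r (p - 1)
           + (1 + (- 1) ^ (n + (\<Sum>j<n. r j))) * alternant n (\<lambda>_. 0) a r"
proof -
  let ?alt = "\<lambda>I. alternant n (\<lambda>_. 0) (flip_signs I a) r"
  let ?T = "\<lambda>I. if I = {} \<or> I = {..<n} then 0 else (- 1) ^ card I * ?alt I"
  have p1: "p - 1 > 0" using p prime_gt_1_nat by force
  have "int p dvd (\<Sum>I\<in>Pow {..<n}. (- 1) ^ card I * (\<Sum>i<n. flip_signs I a i) ^ (p - 1) * ?alt I - ?T I)"
  proof (intro dvd_sum)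
    fix I assume "I \<in> Pow {..<n}"
    then have I: "I \<subseteq> {..<n}" by simp
    have tot: "int p dvd (\<Sum>i<n. a i)" using minimal by (auto simp: minimal_zero_sum_family_def)
    have iff: "int p dvd (\<Sum>i<n. flip_signs I a i) \<longleftrightarrow> I = {} \<or> I = {..<n}"
    proof -
      have "int p dvd (\<Sum>i<n. flip_signs I a i) \<longleftrightarrow> int p dvd 2 * (\<Sum>i\<in>I. a i)"
        unfolding sum_flip_signs[OF I] using tot by (rule dvd_diff_right_iff)
      then show ?thesis
        using prime_odd_dvd_twice[OF p] minimal I by (auto simp: minimal_zero_sum_family_def)
    qed
    show "int p dvd (- 1) ^ card I * (\<Sum>i<n. flip_signs I a i) ^ (p - 1) * ?alt I - ?T I"
    proof (cases "I = {} \<or> I = {..<n}")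
      case True
      then have "int p dvd (\<Sum>i<n. flip_signs I a i) ^ (p - 1)"
        using iff p1 by (auto intro: dvd_power_le dvd_trans[OF _ dvd_power])
      then show ?thesis using True by simp
    next
      case False
      then have "int p dvd (\<Sum>i<n. flip_signs I a i) ^ (p - 1) - 1"
        using iff by (intro fermat_int[OF p(1)]) auto
      then have "int p dvd ((- 1) ^ card I * ?alt I) * ((\<Sum>i<n. flip_signs I a i) ^ (p - 1) - 1)"
        by (rule dvd_mult)
      then show ?thesis using False by (simp add: algebra_simps)
    qed
  qed
  also have "(\<Sum>I\<in>Pow {..<n}. (- 1) ^ card I * (\<Sum>i<n. flip_signs I a i) ^ (p - 1) * ?alt I - ?T I)
      = signed_moment n a r (p - 1) - (\<Sum>I\<in>Pow {..<n}. ?T I)"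
    unfolding signed_moment_def by (rule sum_subtractf)
  also have "(\<Sum>I\<in>Pow {..<n}. ?T I) = (\<Sum>I\<in>Pow {..<n} - {{}, {..<n}}. (- 1) ^ card I * ?alt I)"
    by (intro sum.mono_neutral_cong_right) auto
  also have "\<dots> = (\<Sum>I\<in>Pow {..<n}. (- 1) ^ card I * ?alt I) -
      (\<Sum>I\<in>{{}, {..<n}}. (- 1) ^ card I * ?alt I)"
    by (rule sum_diff) auto
  also have "(\<Sum>I\<in>Pow {..<n}. (- 1) ^ card I * ?alt I) = signed_moment n a r 0"
    by (simp add: signed_moment_def)
  also have "\<dots> = 0" using r by (intro signed_moment_eq_0) simp
  also have "(\<Sum>I\<in>{{}, {..<n}}. (- 1) ^ card I * ?alt I) = ?alt {} + (- 1) ^ n * ?alt {..<n}"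
    using n by (subst sum.insert) auto
  also have "?alt {} = alternant n (\<lambda>_. 0) a r"
    by (simp add: flip_signs_def[abs_def])
  also have "?alt {..<n} = (- 1) ^ (\<Sum>j<n. r j) * alternant n (\<lambda>_. 0) a r"
    unfolding alternant_uminus[symmetric] by (rule alternant_cong) (auto simp: flip_signs_def)
  finally show ?thesis by (simp add: algebra_simps power_add)
qed

lemma sum_two_row_exponents:
  "(\<Sum>j<n + 2. two_row_exponents n u v j) = (\<Sum>j<n. j) + u + v"
  by (simp add: two_row_exponents_def numeral_2_eq_2)

text \<open>
  Proper subsets with one or two elements do not have sum zero, so the \<open>a i\<close> have nonzero and
  pairwise distinct squares modulo \<open>p\<close>. Hence the factor that depends on \<open>a\<close> in the formula for the
  critical degree is a unit.
\<close>

lemma minimal_zero_sum_family_distinct_squares: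
  assumes p: "prime p" and min: "minimal_zero_sum_family p n a" and distinct: "distinct_mod p n a"
    and n: "n \<ge> 3"
  shows "\<not> int p dvd alternant n (\<lambda>_. 0) a odds"
proof -
  have small: "\<not> int p dvd (\<Sum>i\<in>I. a i)" if "I \<subseteq> {..<n}" "I \<noteq> {}" "card I < n" for I
    using min that by (auto simp: minimal_zero_sum_family_def)
  have "\<not> int p dvd a i" if "i < n" for i
    using small[of "{i}"] that n by simp
  moreover have "\<not> int p dvd a j ^ 2 - a i ^ 2" if "i < j" "j < n" for i j
  proof -
    have "\<not> int p dvd a j + a i" using small[of "{j, i}"] that n by simp
    moreover have "\<not> int p dvd a j - a i" using distinct that by (auto simp: distinct_mod_def)
    moreover have "a j ^ 2 - a i ^ 2 = (a j + a i) * (a j - a i)"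
      by (simp add: power2_eq_square algebra_simps)
    ultimately show ?thesis using p by (simp add: prime_dvd_mult_iff)
  qed
  ultimately show ?thesis
    using p prime_not_dvd_vandermonde[of "int p" n "\<lambda>i. a i ^ 2"]
    by (auto simp: alternant_odds prime_dvd_mult_iff prime_dvd_prod_iff)
qed

lemma prime_dvd_fact_int: "prime p \<Longrightarrow> k < p \<Longrightarrow> \<not> int p dvd fact k"
  by (metis int_dvd_int_iff not_le of_nat_fact prime_dvd_fact_iff)

lemma not_dvd_small: "0 < x \<Longrightarrow> x < int p \<Longrightarrow> \<not> int p dvd x"
  by (auto dest: zdvd_imp_le)

text \<open>
  Let \<open>V\<close> be the Vandermonde determinant of the \<open>a i\<close> and \<open>h_j\<close> their complete symmetric
  polynomials. Below the critical degree the moment is zero, so \<open>signed_moment_minimal\<close> gives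
  \<open>2 * V * h_j = 0\<close> modulo \<open>p\<close> for all \<open>j \<le> \<delta>\<close> with \<open>j + \<delta>\<close> odd. For odd \<open>\<delta>\<close> the case \<open>j = 0\<close> is
  absurd. For even \<open>\<delta> \<ge> 6\<close> put \<open>m = \<delta> - 2\<close>; then \<open>h_3\<close> and \<open>h_(m + 1)\<close> vanish, hence so does the
  Schur polynomial \<open>h_3 * h_m - h_2 * h_(m + 1)\<close> of degree \<open>\<delta> + 1\<close>. Its moment is therefore zero
  modulo \<open>p\<close>. But this moment has exactly the critical degree, and \<open>signed_moment_top\<close> with
  \<open>falling_minor\<close> shows that it is a unit. For \<open>\<delta> = 4\<close> the argument breaks down at the factor \<open>m - 2\<close>.
\<close>

lemma minimal_zero_sum_excess:
  assumes p: "prime p" "odd p"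
    and min: "minimal_zero_sum_family p n a" and distinct: "distinct_mod p n a"
    and n: "n \<ge> 3" and excess: "n * (n + 1) = 2 * (p + \<delta>)" and \<delta>: "0 < \<delta>" "\<delta> < n"
  shows "\<delta> = 2 \<or> \<delta> = 4"
proof -
  let ?alt = "alternant n (\<lambda>_. 0) a"
  \<comment> \<open>The exponents are \<open>0, \<dots>, N - 1\<close> followed by two free ones.\<close>
  define N where "N = n - 2"
  have nN: "n = N + 2" using n by (simp add: N_def)
  define H where "H j = newton_coeff (\<lambda>_. 0) a (N + 1 + j) (N + 1)" for j
  have V: "\<not> int p dvd vandermonde n a"
    using prime_not_dvd_vandermonde[of "int p" n a] p(1) distinct by (auto simp: distinct_mod_def)
  have p2: "p > 2" using p prime_ge_2_nat[of p] by (cases "p = 2") auto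
  have ex: "N * N + 5 * N + 6 = 2 * p + 2 * \<delta>"
    using excess unfolding nN by (simp add: algebra_simps)
  have n2: "n ^ 2 = N * N + 4 * N + 4"
    unfolding nN by (simp add: power2_eq_square algebra_simps)
  have deg: "2 * (\<Sum>j<n. two_row_exponents N u v j) + N = N * N + 2 * u + 2 * v" for u v
    using sum_two_row_exponents[of N u v] sum_initial[of N] unfolding nN by simp
  define minor where "minor u v = newton_coeff (\<lambda>_. 0) a u N * newton_coeff (\<lambda>_. 0) a v (N + 1)
      - newton_coeff (\<lambda>_. 0) a u (N + 1) * newton_coeff (\<lambda>_. 0) a v N" for u v
  have alt_minor: "?alt (two_row_exponents N u v) = vandermonde n a * minor u v" for u v
    unfolding nN minor_def by (rule alternant_two_row)
  have moment: "int p dvd signed_moment n a (two_row_exponents N u v) (p - 1) + 2 * (vandermonde n a * minor u v)"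
    if "u + v \<le> 2 * N + 2 + \<delta>" "even (\<delta> + u + v)" for u v
  proof -
    let ?d = "\<Sum>j<n. two_row_exponents N u v j"
    have "?d < n ^ 2" using deg[of u v] that(1) ex n2 p2 by linarith
    moreover have "even (n + ?d)"
    proof -
      have "n + ?d + 2 * N + 1 = p + \<delta> + u + v" using deg[of u v] ex nN by linarith
      moreover have "odd (p + \<delta> + u + v)" using that(2) p(2) by presburger
      ultimately have "odd (n + ?d + 2 * N + 1)" by (simp only: not_False_eq_True)
      then show ?thesis by simp
    qed
    ultimately show ?thesis
      using signed_moment_minimal[OF p min, of "two_row_exponents N u v"] n by (simp add: alt_minor)
  qed
  have vanish: "int p dvd H j" if "j \<le> \<delta>" "even (j + \<delta> + 1)" for j
  proof -
    have "signed_moment n a (two_row_exponents N N (N + 1 + j)) (p - 1) = 0"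
    proof (rule signed_moment_eq_0)
      show "(\<Sum>i<n. two_row_exponents N N (N + 1 + j) i) + (p - 1) < n ^ 2"
        using deg[of N "N + 1 + j"] that(1) ex n2 p2 by simp
    qed
    moreover have "minor N (N + 1 + j) = H j"
      by (simp add: minor_def H_def newton_coeff_eq_0 del: newton_coeff.simps)
    moreover have "even (\<delta> + N + (N + 1 + j))" using that(2) by presburger
    ultimately have "int p dvd 2 * (vandermonde n a * H j)"
      using moment[of N "N + 1 + j"] that(1) by simp
    then have "int p dvd vandermonde n a * H j" by (simp only: prime_odd_dvd_twice[OF p])
    then show ?thesis using V p(1) by (simp add: prime_dvd_mult_iff)
  qed
  have even: "even \<delta>"
  proof (rule ccontr)
    assume "odd \<delta>"
    then have "int p dvd H 0" by (intro vanish) auto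
    moreover have "H 0 = 1" by (simp add: H_def del: newton_coeff.simps)
    ultimately show False using p2 by simp
  qed
  show ?thesis
  proof (rule ccontr)
    assume "\<not> (\<delta> = 2 \<or> \<delta> = 4)"
    with even \<delta>(1) have "\<delta> \<ge> 6" by presburger
    then obtain m where m: "\<delta> = m + 2" "m \<ge> 4" 
      by (intro that[of "\<delta> - 2"]) auto
    have mN: "m < N" using m \<delta>(2) nN by simp
    have N5: "5 \<le> N" using mN m by simp
    then have N2: "2 \<le> N" by simp
    \<comment> \<open>All factorials and differences of odd numbers below involve only numbers less than \<open>p\<close>.\<close>
    have big: "2 * n \<le> p"
    proof -
      have "5 * N \<le> N * N" using N5 by (intro mult_right_mono) auto
      then show ?thesis using ex m mN nN N5 by linarith
    qed
    \<comment> \<open>The recursion removes the last variable, which relates the Newton coefficients at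
      \<open>N\<close> to the complete symmetric polynomials in all \<open>N + 2\<close> variables.\<close>
    have "H 3 = newton_coeff (\<lambda>_. 0) a (N + 3) N + a (N + 1) * H 2"
      "H (m + 1) = newton_coeff (\<lambda>_. 0) a (N + 1 + m) N + a (N + 1) * H m"
      by (simp_all add: H_def numeral_eq_Suc)
    then have "minor (N + 3) (N + 1 + m) = (H 3 - a (N + 1) * H 2) * H m - H 2 * (H (m + 1) - a (N + 1) * H m)"
      by (simp add: minor_def H_def numeral_3_eq_3 numeral_2_eq_2 del: newton_coeff.simps)
    also have "\<dots> = H 3 * H m - H 2 * H (m + 1)" by (simp add: algebra_simps)
    also have "int p dvd \<dots>"
      using vanish[of 3] vanish[of "m + 1"] m even by (intro dvd_diff) auto
    finally have "int p dvd 2 * (vandermonde n a * minor (N + 3) (N + 1 + m))" by simp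
    moreover have "int p dvd signed_moment n a (two_row_exponents N (N + 3) (N + 1 + m)) (p - 1)
        + 2 * (vandermonde n a * minor (N + 3) (N + 1 + m))"
      using m even by (intro moment) auto
    ultimately have "int p dvd signed_moment n a (two_row_exponents N (N + 3) (N + 1 + m)) (p - 1)"
      by (simp add: dvd_add_left_iff)
    then have "int p dvd (\<Prod>i<n. fact (odds i)) * signed_moment n a (two_row_exponents N (N + 3) (N + 1 + m)) (p - 1)"
      by (rule dvd_mult)
    also have "\<dots> = 2 ^ n * ?alt odds * fact (p - 1) * falling_alternant n (two_row_exponents N (N + 3) (N + 1 + m))"
      using deg[of "N + 3" "N + 1 + m"] m ex n2 p2 by (intro signed_moment_top) simp
    finally have "int p dvd falling_alternant n (two_row_exponents N (N + 3) (N + 1 + m))"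
      using minimal_zero_sum_family_distinct_squares[OF p(1) min distinct n] prime_dvd_fact_int[OF p(1), of "p - 1"] p p2
        prime_odd_dvd_twice[OF p, of 1] prime_dvd_power[of "int p" 2 n]
      by (auto simp: prime_dvd_mult_iff)
    moreover have "\<not> int p dvd vandermonde n (\<lambda>i. int (odds i))"
    proof (rule prime_not_dvd_vandermonde)
      fix i j assume "i < j" "j < n"
      show "\<not> int p dvd int (odds j) - int (odds i)"
        using \<open>i < j\<close> \<open>j < n\<close> big by (intro not_dvd_small) (auto simp: odds_def)
    qed (use p in auto)
    ultimately have dvd: "int p dvd newton_coeff int (\<lambda>i. int (odds i)) (N + 3) N * newton_coeff int (\<lambda>i. int (odds i)) (N + 1 + m) (N + 1)
       - newton_coeff int (\<lambda>i. int (odds i)) (N + 3) (N + 1) * newton_coeff int (\<lambda>i. int (odds i)) (N + 1 + m) N"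
      using p(1) unfolding nN alternant_two_row by (simp add: prime_dvd_mult_iff)
    have "int p dvd fact (N + 4) * fact (N + 2 + m) *
           ((int m - 2) * (int ((N + 2) * (N + 3)) - 3 * int m - 3))"
      unfolding falling_minor[OF N2 mN, symmetric] by (rule dvd_mult2[OF dvd])
    moreover have "\<not> int p dvd int m - 2" using m big mN nN by (intro not_dvd_small) auto
    moreover have "\<not> int p dvd int ((N + 2) * (N + 3)) - 3 * int m - 3"
    proof
      have "int ((N + 2) * (N + 3)) - 3 * int m - 3 = 2 * int p - (int m - 1)"
      proof -
        have "(N + 2) * (N + 3) = 2 * (p + m + 2)" using excess nN m by (simp add: algebra_simps)
        then show ?thesis unfolding \<open>(N + 2) * (N + 3) = 2 * (p + m + 2)\<close> by simp
      qed
      moreover assume "int p dvd int ((N + 2) * (N + 3)) - 3 * int m - 3"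
      ultimately have "int p dvd 2 * int p - (int m - 1)" by (simp only:)
      then have "int p dvd int m - 1"
        by (metis dvd_diff_right_iff dvd_triv_right)
      moreover have "\<not> int p dvd int m - 1" using m big mN nN by (intro not_dvd_small) auto
      ultimately show False by simp
    qed
    ultimately show False
      using prime_dvd_fact_int[OF p(1), of "N + 4"] prime_dvd_fact_int[OF p(1), of "N + 2 + m"] p(1)
        big mN nN N5
      by (simp add: prime_dvd_mult_iff del: fact_Suc)
  qed
qed

section \<open>Sets in the cyclic group\<close>

lemma finprod_integer_mod_group:
  assumes "p > 0" "finite S" "S \<subseteq> {0..<int p}"
  shows "finprod (integer_mod_group p) (\<lambda>x. x) S = (\<Sum>S) mod int p"
proof -
  interpret comm_group "integer_mod_group p" by (rule abelian_integer_mod_group)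
  from assms(2,3) show ?thesis
  proof (induction S)
    case (insert x F)
    then have "finprod (integer_mod_group p) (\<lambda>x. x) (insert x F) = (x + (\<Sum>F) mod int p) mod int p"
      using assms(1) by (subst finprod_insert) (auto simp: carrier_integer_mod_group)
    with insert show ?case by (simp add: mod_add_right_eq)
  qed (simp add: finprod_empty)
qed

lemma zero_sum_set_integer_mod_group:
  assumes "p > 0"
  shows "zero_sum_set (integer_mod_group p) S \<longleftrightarrow>
           S \<noteq> {} \<and> S \<subseteq> {0..<int p} \<and> int p dvd \<Sum>S"
proof (cases "S \<subseteq> {0..<int p}")
  case True
  then have "finite S" by (rule finite_subset) simp
  with True assms show ?thesis
    by (simp add: zero_sum_set_def carrier_integer_mod_group finprod_integer_mod_group dvd_eq_mod_eq_0)
qed (use assms in \<open>auto simp: zero_sum_set_def carrier_integer_mod_group\<close>)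

lemma distinct_mod_enumeration:
  assumes "bij_betw a {..<n} S" "S \<subseteq> {0..<int p}"
  shows "distinct_mod p n a"
  unfolding distinct_mod_def
proof (intro allI impI notI)
  fix i j assume ij: "i < n" "j < n" "i \<noteq> j" and dvd: "int p dvd a i - a j"
  have "a i \<in> S" "a j \<in> S" "a i \<noteq> a j"
    using ij assms(1) by (auto simp: bij_betw_def inj_on_def)
  then have "a i \<in> {0..<int p}" "a j \<in> {0..<int p}" "a i - a j \<noteq> 0" using assms(2) by auto
  with dvd_imp_le_int[OF _ dvd] show False by auto
qed

lemma zero_sum_free_set_bound:
  assumes p: "prime p" "odd p" and S: "S \<subseteq> {0..<int p}"
    and free: "\<And>T. T \<subseteq> S \<Longrightarrow> \<not> zero_sum_set (integer_mod_group p) T"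
  shows "card S * (card S + 1) < 2 * p"
proof -
  have p0: "p > 0" using p by (simp add: prime_gt_0_nat)
  have "finite S" using S by (rule finite_subset) simp
  then obtain a where a: "bij_betw a {..<card S} S"
    using ex_bij_betw_nat_finite[of S] by (auto simp: atLeast0LessThan)
  have "zero_sum_free_family p (card S) a"
    unfolding zero_sum_free_family_def
  proof (intro allI impI)
    fix I assume I: "I \<subseteq> {..<card S}" "I \<noteq> {}"
    have "inj_on a I" using a I by (auto simp: bij_betw_def intro: inj_on_subset)
    then have "(\<Sum>i\<in>I. a i) = \<Sum>(a ` I)" by (simp add: sum.reindex)
    moreover have "a ` I \<subseteq> S" using a I by (auto simp: bij_betw_def)
    ultimately show "\<not> int p dvd (\<Sum>i\<in>I. a i)"
      using free[of "a ` I"] S I by (auto simp: zero_sum_set_integer_mod_group[OF p0])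
  qed
  then show ?thesis
    using zero_sum_free_bound[OF p] distinct_mod_enumeration[OF a S] by blast
qed

lemma minimal_zero_sum_set_excess:
  assumes p: "prime p" "odd p" and min: "minimal_zero_sum_set (integer_mod_group p) S"
    and "card S \<ge> 3" "card S * (card S + 1) = 2 * (p + \<delta>)" "0 < \<delta>" "\<delta> < card S"
  shows "\<delta> = 2 \<or> \<delta> = 4"
proof -
  have p0: "p > 0" using p by (simp add: prime_gt_0_nat)
  have S: "S \<subseteq> {0..<int p}" "int p dvd \<Sum>S"
    using min by (auto simp: minimal_zero_sum_set_def zero_sum_set_integer_mod_group[OF p0])
  have "finite S" using S(1) by (rule finite_subset) simp
  then obtain a where a: "bij_betw a {..<card S} S"
    using ex_bij_betw_nat_finite[of S] by (auto simp: atLeast0LessThan)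
  have "minimal_zero_sum_family p (card S) a"
    unfolding minimal_zero_sum_family_def
  proof (intro allI impI)
    fix I assume I: "I \<subseteq> {..<card S}"
    have "inj_on a I" using a I by (auto simp: bij_betw_def intro: inj_on_subset)
    then have sum: "(\<Sum>i\<in>I. a i) = \<Sum>(a ` I)" by (simp add: sum.reindex)
    have sub: "a ` I \<subseteq> S" using a I by (auto simp: bij_betw_def)
    have "a ` I = S \<longleftrightarrow> I = {..<card S}"
      using a I by (auto simp: bij_betw_def inj_on_image_eq_iff)
    moreover have "int p dvd \<Sum>(a ` I) \<longleftrightarrow> a ` I = {} \<or> a ` I = S"
      using min S sub unfolding minimal_zero_sum_set_def zero_sum_set_integer_mod_group[OF p0]
      by (metis dvd_0_right order.trans psubsetI sum.empty)
    ultimately show "int p dvd (\<Sum>i\<in>I. a i) \<longleftrightarrow> I = {} \<or> I = {..<card S}"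
      unfolding sum by simp
  qed
  then show ?thesis
    using minimal_zero_sum_excess[OF p] distinct_mod_enumeration[OF a S(1)] assms by blast
qed

lemma sum_subset_less:
  fixes B :: "nat set"
  assumes "finite B" "T \<subset> B" "0 \<notin> B"
  shows "\<Sum>T < \<Sum>B"
proof -
  obtain b where "b \<in> B - T" using assms(2) by blast
  then show ?thesis
    using assms by (intro sum_strict_mono2[of B T b]) (auto intro!: Nat.gr0I)
qed

lemma sum_pos_nat:
  fixes T :: "nat set"
  assumes "finite T" "T \<noteq> {}" "0 \<notin> T"
  shows "0 < \<Sum>T"
  using assms by (metis gr0I sum_eq_0_iff all_not_in_conv)

lemma minimal_zero_sum_set_of_nat:
  assumes p: "p > 0" and B: "B \<subseteq> {0<..<p}" "B \<noteq> {}" "p dvd \<Sum>B"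
    and min: "\<And>T. T \<subset> B \<Longrightarrow> T \<noteq> {} \<Longrightarrow> \<not> p dvd \<Sum>T"
  shows "minimal_zero_sum_set (integer_mod_group p) (int ` B)"
proof -
  have sum: "\<Sum>(int ` T) = int (\<Sum>T)" for T
    by (simp add: sum.reindex)
  have "\<not> int p dvd \<Sum>T'" if T': "T' \<subset> int ` B" "T' \<noteq> {}" for T'
  proof -
    obtain T where T: "T' = int ` T" "T \<subseteq> B" using T' by (meson psubset_imp_subset subset_imageE)
    then have "T \<subset> B" "T \<noteq> {}" using T' by auto
    then show ?thesis using min[of T] unfolding T(1) sum by (simp only: int_dvd_int_iff not_False_eq_True)
  qed
  moreover have "int ` B \<subseteq> {0..<int p}" "int ` B \<noteq> {}" using B by auto
  moreover have "int p dvd \<Sum>(int ` B)"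
    unfolding sum using B(3) by (simp only: int_dvd_int_iff)
  ultimately show ?thesis
    unfolding minimal_zero_sum_set_def zero_sum_set_integer_mod_group[OF p] by blast
qed

text \<open>
  With positive representatives that add up to \<open>p\<close> itself, no proper subset can reach a multiple
  of \<open>p\<close>.
\<close>

lemma minimal_zero_sum_set_positive:
  assumes p: "p > 0" and B: "B \<subseteq> {0<..<p}" "\<Sum>B = p"
  shows "minimal_zero_sum_set (integer_mod_group p) (int ` B)"
proof (rule minimal_zero_sum_set_of_nat[OF p B(1)])
  have fin: "finite B" using B(1) by (rule finite_subset) simp
  show "\<not> p dvd \<Sum>T" if T: "T \<subset> B" "T \<noteq> {}" for T
  proof -
    have "0 \<notin> B" using B(1) by auto
    then have "\<Sum>T < p" using sum_subset_less[OF fin T(1)] B(2) by simp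
    moreover have "0 < \<Sum>T"
      using T B fin by (intro sum_pos_nat) (auto intro: finite_subset)
    ultimately show ?thesis by (auto dest: dvd_imp_le)
  qed
qed (use B p in auto)

text \<open>
  The element \<open>p - c\<close> plays the part of \<open>- c\<close>. A proper zero-sum subset would yield a subset of \<open>B\<close>
  with sum \<open>c\<close>: either together with \<open>- c\<close>, or as the complement of a subset with sum \<open>p\<close>.
\<close>

lemma minimal_zero_sum_set_one_negative:
  assumes c: "0 < c" "c < p" and B: "B \<subseteq> {0<..<p - c}" "\<Sum>B = p + c"
    and no_c: "\<And>T. T \<subseteq> B \<Longrightarrow> \<Sum>T \<noteq> c"
  shows "minimal_zero_sum_set (integer_mod_group p) (int ` insert (p - c) B)"
proof (rule minimal_zero_sum_set_of_nat)
  have fin: "finite B" using B(1) by (rule finite_subset) simp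
  show "insert (p - c) B \<subseteq> {0<..<p}" using B(1) c by fastforce
  have notin: "p - c \<notin> B" "0 \<notin> B" using B(1) by auto
  show "p dvd \<Sum>(insert (p - c) B)" using fin notin B(2) c by simp
  show "\<not> p dvd \<Sum>T" if T: "T \<subset> insert (p - c) B" "T \<noteq> {}" for T
  proof
    assume "p dvd \<Sum>T"
    then obtain q where q: "\<Sum>T = p * q" by blast
    define U where "U = T - {p - c}"
    have U: "U \<subseteq> B" "finite U" using T fin by (auto simp: U_def intro: finite_subset)
    have le: "\<Sum>U \<le> \<Sum>B" by (rule sum_mono2) (use U fin in auto)
    show False
    proof (cases "p - c \<in> T")
      case True
      then have "T = insert (p - c) U" "p - c \<notin> U" by (auto simp: U_def)
      then have sum: "\<Sum>T = p - c + \<Sum>U" using U by simp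
      have "U \<subset> B" using \<open>T = insert (p - c) U\<close> T U by auto
      then have "\<Sum>U < \<Sum>B" using fin notin by (intro sum_subset_less)
      then have "p * q < p * 2" using q sum B(2) c by linarith
      moreover have "p * q > 0" using q sum c by linarith
      ultimately have "q = 1" by auto
      then have "\<Sum>U = c" using q sum c by simp
      then show False using no_c U by blast
    next
      case False
      then have "T = U" by (simp add: U_def)
      have "\<Sum>T > 0" using T U notin by (intro sum_pos_nat) (auto simp: \<open>T = U\<close>)
      moreover have "p * q < p * 2" using q le B(2) c unfolding \<open>T = U\<close> by linarith
      ultimately have "q = 1" using q by (cases q) auto
      have "\<Sum>(B - U) = \<Sum>B - \<Sum>U" using U fin by (intro sum_diff_nat) auto
      then have "\<Sum>(B - U) = c" using q \<open>q = 1\<close> \<open>T = U\<close> B(2) by simp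
      then show False using no_c[of "B - U"] by auto
    qed
  qed
qed (use B c in auto)

lemma gauss_sum: "2 * \<Sum>{1..m} = m * (m + 1)" for m :: nat
  by (induction m) auto

text \<open>
  The upper bound is \<open>zero_sum_free_set_bound\<close>; the zero-sum free set \<open>{1..K - 1}\<close> shows that it
  is attained.
\<close>

lemma olson_constant_prime:
  assumes p: "prime p" "odd p" and K: "(K - 1) * K < 2 * p" "2 * p \<le> K * (K + 1)"
  shows "olson_constant (integer_mod_group p) = K"
  unfolding olson_constant_def
proof (rule Least_equality)
  have p0: "p > 0" using p by (simp add: prime_gt_0_nat)
  then have car: "carrier (integer_mod_group p) = {0..<int p}"
    by (simp add: carrier_integer_mod_group)
  show "\<forall>S. S \<subseteq> carrier (integer_mod_group p) \<and> K \<le> card S \<longrightarrow>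
          (\<exists>T. T \<subseteq> S \<and> zero_sum_set (integer_mod_group p) T)"
  proof (intro allI impI, rule ccontr)
    fix S assume S: "S \<subseteq> carrier (integer_mod_group p) \<and> K \<le> card S"
      and "\<not> (\<exists>T. T \<subseteq> S \<and> zero_sum_set (integer_mod_group p) T)"
    then have "card S * (card S + 1) < 2 * p"
      using zero_sum_free_set_bound[OF p, of S] by (auto simp: car)
    moreover have "K * (K + 1) \<le> card S * (card S + 1)" using S by (intro mult_le_mono) auto
    ultimately show False using K(2) by simp
  qed
  fix l assume l: "\<forall>S. S \<subseteq> carrier (integer_mod_group p) \<and> l \<le> card S \<longrightarrow>
          (\<exists>T. T \<subseteq> S \<and> zero_sum_set (integer_mod_group p) T)"
  show "K \<le> l"
  proof (rule ccontr)
    assume "\<not> K \<le> l"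
    then have "l \<le> K - 1" by simp
    let ?B = "{1..K - 1}"
    have total: "\<Sum>?B < p" using gauss_sum[of "K - 1"] K by (cases K) auto
    have "x < p" if "x \<in> ?B" for x
      using member_le_sum[of x ?B "\<lambda>x. x"] that total by simp
    then have sub: "int ` ?B \<subseteq> {0..<int p}" by auto
    moreover have "card (int ` ?B) = K - 1" by (simp add: card_image)
    ultimately obtain T' where T': "T' \<subseteq> int ` ?B" "zero_sum_set (integer_mod_group p) T'"
      using l[rule_format, of "int ` ?B"] \<open>l \<le> K - 1\<close> unfolding car by metis
    obtain T where T: "T' = int ` T" "T \<subseteq> ?B" using T'(1) by (meson subset_imageE)
    have "\<Sum>T' = int (\<Sum>T)" by (simp add: T sum.reindex)
    moreover have "int p dvd \<Sum>T'" "T' \<noteq> {}"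
      using T'(2) by (simp_all add: zero_sum_set_integer_mod_group[OF p0])
    ultimately have "p dvd \<Sum>T" "T \<noteq> {}"
      using T(1) by (simp_all only: int_dvd_int_iff image_is_empty not_False_eq_True)
    moreover have "\<Sum>T \<le> \<Sum>?B" using T by (intro sum_mono2) auto
    moreover have "0 < \<Sum>T" using T \<open>T \<noteq> {}\<close> by (intro sum_pos_nat) (auto intro: finite_subset)
    ultimately show False using total by (auto dest: dvd_imp_le)
  qed
qed

text \<open>
  Removing one element from a minimal zero-sum set leaves a zero-sum free set, which bounds its
  size by \<open>K\<close>. The size \<open>K - 1\<close> is always attained: add to \<open>1, \<dots>, K - 2\<close> the number that
  completes the sum to \<open>p\<close>.
\<close>

lemma strong_davenport_constant_prime:
  assumes p: "prime p" "odd p" and K: "(K - 1) * K < 2 * p" "2 * p \<le> K * (K + 1)" "K \<ge> 3"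
  shows "strong_davenport_constant (integer_mod_group p) =
    (if \<exists>S. minimal_zero_sum_set (integer_mod_group p) S \<and> card S = K then K else K - 1)"
proof -
  let ?C = "{card S | S. minimal_zero_sum_set (integer_mod_group p) S}"
  have p0: "p > 0" using p by (simp add: prime_gt_0_nat)
  have upper: "card S \<le> K" if min: "minimal_zero_sum_set (integer_mod_group p) S" for S
  proof -
    from min obtain x where x: "x \<in> S" and S: "S \<subseteq> {0..<int p}"
      by (auto simp: minimal_zero_sum_set_def zero_sum_set_integer_mod_group[OF p0])
    have fin: "finite S" using S by (rule finite_subset) simp
    have "card (S - {x}) * (card (S - {x}) + 1) < 2 * p"
    proof (rule zero_sum_free_set_bound[OF p])
      fix T assume "T \<subseteq> S - {x}"
      then have "T \<subset> S" using x by auto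
      then show "\<not> zero_sum_set (integer_mod_group p) T"
        using min by (simp add: minimal_zero_sum_set_def)
    qed (use S in auto)
    also note K(2)
    finally have "card (S - {x}) < K"
      using mult_le_mono[of K "card (S - {x})" "K + 1" "card (S - {x}) + 1"] by linarith
    then show ?thesis using x fin by simp
  qed
  then have fin: "finite ?C" by (intro finite_subset[of ?C "{..K}"]) auto
  have lower: "K - 1 \<in> ?C"
  proof -
    obtain k where k: "K = k + 2" using K(3) 
      using K(3) by (intro that[of "K - 2"]) auto
    let ?s = "\<Sum>{1..k}"
    have s: "2 * ?s = k * (k + 1)" by (rule gauss_sum)
    define x where "x = p - ?s"
    have x: "k + 1 < x" "x < p" "x + ?s = p"
      using s K(1,3) p0 unfolding k x_def by (auto simp: algebra_simps)
    let ?B = "insert x {1..k}"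
    have "minimal_zero_sum_set (integer_mod_group p) (int ` ?B)"
      using x by (intro minimal_zero_sum_set_positive[OF p0]) auto
    moreover have "card (int ` ?B) = K - 1" using x k by (subst card_image) auto
    ultimately show ?thesis by (auto intro!: exI[of _ "int ` ?B"])
  qed
  show ?thesis
  proof (cases "\<exists>S. minimal_zero_sum_set (integer_mod_group p) S \<and> card S = K")
    case True
    then have "Max ?C = K" using fin upper by (intro Max_eqI) auto
    then show ?thesis using True by (simp add: strong_davenport_constant_def)
  next
    case False
    have "Max ?C = K - 1"
    proof (rule Max_eqI[OF fin _ lower])
      fix c assume "c \<in> ?C"
      then have "c \<le> K" "c \<noteq> K" using upper False by auto
      then show "c \<le> K - 1" by simp
    qed
    then show ?thesis using False by (simp only: strong_davenport_constant_def if_False)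
  qed
qed

text \<open>
  The set \<open>{- 1, 2, 3, \<dots>, k}\<close> here, and \<open>{- 2, 1, 3, 4, \<dots>, k}\<close> for the excess \<open>4\<close>, sum to \<open>p\<close>.
\<close>

lemma exists_minimal_zero_sum_set_excess_2:
  assumes "k * (k + 1) = 2 * (p + 2)" "k \<ge> 6"
  shows "\<exists>S. minimal_zero_sum_set (integer_mod_group p) S \<and> card S = k"
proof -
  let ?B = "{2..k}"
  have "\<Sum>{1..k} = 1 + \<Sum>?B" using assms(2) by (subst sum.atLeast_Suc_atMost) (auto simp: numeral_2_eq_2)
  then have sum: "\<Sum>?B = p + 1" using gauss_sum[of k] assms(1) by simp
  have "6 * k \<le> k * k" using assms(2) by (rule mult_right_mono) simp
  moreover have "k * k + k = 2 * p + 4" using assms(1) by simp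
  ultimately have kp: "k < p - 1" "1 < p" using assms(2) by linarith+
  have "\<Sum>T \<noteq> 1" if "T \<subseteq> ?B" for T
  proof
    assume 1: "\<Sum>T = 1"
    then obtain x where "x \<in> T" by fastforce
    moreover have "finite T" using that by (rule finite_subset) simp
    ultimately show False using member_le_sum[of x T "\<lambda>x. x"] that 1 by auto
  qed
  then have "minimal_zero_sum_set (integer_mod_group p) (int ` insert (p - 1) ?B)"
    using sum kp by (intro minimal_zero_sum_set_one_negative) auto
  moreover have "card (int ` insert (p - 1) ?B) = k" using kp assms(2) by (subst card_image) auto
  ultimately show ?thesis by blast
qed

lemma exists_minimal_zero_sum_set_excess_4:
  assumes "k * (k + 1) = 2 * (p + 4)" "k \<ge> 6"
  shows "\<exists>S. minimal_zero_sum_set (integer_mod_group p) S \<and> card S = k"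
proof -
  let ?B = "insert 1 {3..k}"
  have "{1..k} = insert 2 ?B" using assms(2) by auto
  then have "\<Sum>{1..k} = 2 + \<Sum>?B" by simp
  moreover have "\<Sum>{1..k} = p + 4" using gauss_sum[of k] assms(1) by simp
  ultimately have sum: "\<Sum>?B = p + 2" by presburger
  have "6 * k \<le> k * k" using assms(2) by (rule mult_right_mono) simp
  moreover have "k * k + k = 2 * p + 8" using assms(1) by simp
  ultimately have kp: "k < p - 2" "2 < p" using assms(2) by linarith+
  have "\<Sum>T \<noteq> 2" if "T \<subseteq> ?B" for T
  proof
    assume 2: "\<Sum>T = 2"
    have fin: "finite T" using that by (rule finite_subset) simp
    have "x \<le> 2" if "x \<in> T" for x using member_le_sum[of x T "\<lambda>x. x"] that 2 fin by simp
    with that have "T \<subseteq> {1}" by force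
    then have "\<Sum>T \<le> \<Sum>{1::nat}" by (intro sum_mono2) auto
    then show False using 2 by simp
  qed
  then have "minimal_zero_sum_set (integer_mod_group p) (int ` insert (p - 2) ?B)"
    using sum kp assms(2) by (intro minimal_zero_sum_set_one_negative) auto
  moreover have "card (int ` insert (p - 2) ?B) = k" using kp assms(2) by (subst card_image) auto
  ultimately show ?thesis by blast
qed

section \<open>The strong Davenport constant and the Olson constant\<close>

text \<open>
  The bound \<open>17\<close> guarantees \<open>K \<ge> 6\<close>. Excess \<open>0\<close> would make \<open>2 * p = K * (K + 1)\<close>, which is
  impossible for a prime of this size; the excess is less than \<open>K\<close> by minimality of \<open>K\<close>.
\<close>

lemma strong_davenport_olson_prime:
  assumes p: "prime p" "p \<ge> 17"
  shows "if \<exists>k. k * (k + 1) = 2 * (p + 2) \<or> k * (k + 1) = 2 * (p + 4)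
    then strong_davenport_constant (integer_mod_group p) = olson_constant (integer_mod_group p)
    else strong_davenport_constant (integer_mod_group p) + 1 = olson_constant (integer_mod_group p)"
proof -
  have odd: "odd p" using p by (intro prime_odd_nat) auto
  define K where "K = (LEAST k. 2 * p \<le> k * (k + 1))"
  have K2: "2 * p \<le> K * (K + 1)" unfolding K_def by (rule LeastI[of _ "2 * p"]) simp
  have K6: "K \<ge> 6"
  proof (rule ccontr)
    assume "\<not> K \<ge> 6"
    then have "K * (K + 1) \<le> 5 * 6" by (intro mult_le_mono) auto
    then show False using K2 p by simp
  qed
  have K1: "(K - 1) * K < 2 * p"
    using not_less_Least[of "K - 1" "\<lambda>k. 2 * p \<le> k * (k + 1)"] K6 unfolding K_def[symmetric] by simp
  have olson: "olson_constant (integer_mod_group p) = K"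
    by (rule olson_constant_prime[OF p(1) odd K1 K2])
  have sd: "strong_davenport_constant (integer_mod_group p) =
    (if \<exists>S. minimal_zero_sum_set (integer_mod_group p) S \<and> card S = K then K else K - 1)"
    using K6 by (intro strong_davenport_constant_prime[OF p(1) odd K1 K2]) simp
  show ?thesis
  proof (cases "\<exists>k. k * (k + 1) = 2 * (p + 2) \<or> k * (k + 1) = 2 * (p + 4)")
    case True
    then obtain k where k: "k * (k + 1) = 2 * (p + 2) \<or> k * (k + 1) = 2 * (p + 4)" by blast
    have k6: "k \<ge> 6"
    proof (rule ccontr)
      assume "\<not> k \<ge> 6"
      then have "k * (k + 1) \<le> 5 * 6" by (intro mult_le_mono) auto
      then show False using k p(2) by auto
    qed
    have "(k - 1) * k < 2 * p" using k k6 by (cases k) auto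
    moreover have "2 * p \<le> k * (k + 1)" using k by auto
    ultimately have "olson_constant (integer_mod_group p) = k"
      by (rule olson_constant_prime[OF p(1) odd])
    with olson have "k = K" by simp
    then have "\<exists>S. minimal_zero_sum_set (integer_mod_group p) S \<and> card S = K"
      using k k6 exists_minimal_zero_sum_set_excess_2 exists_minimal_zero_sum_set_excess_4 by blast
    then show ?thesis using True sd olson by simp
  next
    case False
    have "\<not> (\<exists>S. minimal_zero_sum_set (integer_mod_group p) S \<and> card S = K)"
    proof
      assume "\<exists>S. minimal_zero_sum_set (integer_mod_group p) S \<and> card S = K"
      then obtain S where S: "minimal_zero_sum_set (integer_mod_group p) S" "card S = K" by blast
      have "even (K * (K + 1))" by simp
      then obtain t where t: "K * (K + 1) = 2 * t" by blast
      define \<delta> where "\<delta> = t - p"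
      have \<delta>: "K * (K + 1) = 2 * (p + \<delta>)" using t K2 by (simp add: \<delta>_def)
      have sq: "(K - 1) * K + 2 * K = K * (K + 1)" using K6 by (cases K) auto
      have "\<delta> \<noteq> 0"
      proof
        assume "\<delta> = 0"
        then have "p dvd K * (K + 1)" using \<delta> by simp
        then have "p dvd K \<or> p dvd K + 1" using p(1) by (simp only: prime_dvd_mult_iff)
        then have "p \<le> K + 1" using K6 by (auto dest: dvd_imp_le)
        moreover have "5 * K \<le> (K - 1) * K" using K6 by (intro mult_le_mono) auto
        ultimately show False using K1 K6 by linarith
      qed
      moreover have "\<delta> < K"
      proof -
        have "2 * (p + \<delta>) < 2 * p + 2 * K" unfolding \<delta>[symmetric] sq[symmetric] using K1 by simp
        then show ?thesis by simp
      qed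
      ultimately have "\<delta> = 2 \<or> \<delta> = 4"
        using minimal_zero_sum_set_excess[OF p(1) odd S(1), of \<delta>] S(2) \<delta> K6 by simp
      then show False using False \<delta> by blast
    qed
    then show ?thesis using False sd olson K6 by simp
  qed
qed

theorem theorem6p3:
  shows "\<exists>p\<^sub>0::nat. \<forall>p::nat. prime p \<and> p \<ge> p\<^sub>0 \<longrightarrow>
    (if \<exists>k::nat. k > 0 \<and>
          (real p = real k * (real k + 1) / 2 - 2 \<or> real p = real k * (real k + 1) / 2 - 4)
     then strong_davenport_constant (integer_mod_group p)
            = olson_constant (integer_mod_group p)
     else int (strong_davenport_constant (integer_mod_group p))
            = int (olson_constant (integer_mod_group p)) - 1)"
proof (intro exI[of _ 17] allI impI)
  fix p :: nat assume "prime p \<and> p \<ge> 17"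
  then have p: "prime p" "p \<ge> 17" by auto
  have real: "real p = real k * (real k + 1) / 2 - real c \<longleftrightarrow> k * (k + 1) = 2 * (p + c)" for k c
  proof -
    have "real p = real k * (real k + 1) / 2 - real c \<longleftrightarrow> real (k * (k + 1)) = real (2 * (p + c))"
      by (auto simp: field_simps)
    then show ?thesis by (simp only: of_nat_eq_iff)
  qed
  have "(\<exists>k::nat. k > 0 \<and>
          (real p = real k * (real k + 1) / 2 - 2 \<or> real p = real k * (real k + 1) / 2 - 4)) \<longleftrightarrow>
        (\<exists>k. k * (k + 1) = 2 * (p + 2) \<or> k * (k + 1) = 2 * (p + 4))"
    (is "(\<exists>k. ?P k) \<longleftrightarrow> (\<exists>k. ?Q k)")
  proof -
    have "?P k \<longleftrightarrow> ?Q k" for k using real[of k 2] real[of k 4] by (cases "k = 0") auto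
    then show ?thesis by simp
  qed
  then show "if \<exists>k::nat. k > 0 \<and>
          (real p = real k * (real k + 1) / 2 - 2 \<or> real p = real k * (real k + 1) / 2 - 4)
     then strong_davenport_constant (integer_mod_group p)
            = olson_constant (integer_mod_group p)
     else int (strong_davenport_constant (integer_mod_group p))
            = int (olson_constant (integer_mod_group p)) - 1"
    using strong_davenport_olson_prime[OF p] by (auto split: if_splits)
qed

end
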